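(* Let $G$ be a connected noncomplete graph of order $n \geq 5$ with minimum degree $\delta(G) \geq n/4$. If $G$ is isomorphic to neither $G_1$ nor $G_2$, then $pc(G)=2$.
   Context: All graphs are finite, simple and undirected. In an edge-colored graph, a path is a proper path if no two adjacent (consecutive) edges of the path receive the same color. For a connected graph $G$, the proper connection number $pc(G)$ is the minimum number of colors in an edge-coloring of $G$ (adjacent edges may share colors) such that every pair of distinct vertices of $G$ is joined by at least one proper path. $G_1$ is the graph on 7 vertices consisting of three triangles sharing exactly one common vertex (i.e., a vertex $v$ together with three disjoint edges $u_1u_2$, $u_3u_4$, $u_5u_6$, with $v$ adjacent to all of $u_1,\dots,u_6$). $G_2$ is the graph on 8 vertices with vertex set $\{v,u_1,u_2,w_1,w_2,w_3,w_4,w_5\}$ and edge set $\{vu_1, vu_2, u_1u_2, vw_1, w_1w_2, w_1w_5, w_2w_5, w_1w_3, w_1w_4, w_3w_4\}$ (a triangle $vu_1u_2$ joined by the edge $vw_1$ to the center $w_1$ of two triangles $w_1w_2w_5$ and $w_1w_3w_4$ sharing $w_1$). Both satisfy $pc(G_1)=pc(G_2)=3$. *)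

theory Defs
  imports "Graph_Theory.Graph_Theory"
begin

text \<open>
  Finite simple undirected graphs are the library's \<^locale>\<open>pair_graph\<close>s, in which an undirected
  edge $uv$ is the pair of opposite arcs $(u,v)$ and $(v,u)$. Edge colorings must not see this
  orientation, so they are functions on the unordered edges $\{u,v\}$.
\<close>

definition uedges :: "'a pair_pre_digraph \<Rightarrow> 'a set set" where
  "uedges G = {{u, v} | u v. (u, v) \<in> parcs G}"

text \<open>In a symmetric digraph the out-degree of a vertex is its number of neighbours.\<close>

definition min_degree :: "'a pair_pre_digraph \<Rightarrow> nat" where
  "min_degree G = Min (out_degree G ` pverts G)"

definition proper_path :: "'a pair_pre_digraph \<Rightarrow> ('a set \<Rightarrow> nat) \<Rightarrow> 'a list \<Rightarrow> bool" where
  "proper_path G c p \<longleftrightarrow>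
     vpath p G \<and>
     (\<forall>i. i + 2 < length p \<longrightarrow> c {p ! i, p ! (i + 1)} \<noteq> c {p ! (i + 1), p ! (i + 2)})"

definition proper_connected :: "'a pair_pre_digraph \<Rightarrow> ('a set \<Rightarrow> nat) \<Rightarrow> bool" where
  "proper_connected G c \<longleftrightarrow>
     (\<forall>u \<in> pverts G. \<forall>v \<in> pverts G. u \<noteq> v \<longrightarrow>
        (\<exists>p. proper_path G c p \<and> hd p = u \<and> last p = v))"

text \<open>
  Meaningful for connected graphs only. The minimum is then attained: giving all edges
  different colors makes every path proper.
\<close>

definition proper_connection_number :: "'a pair_pre_digraph \<Rightarrow> nat" where
  "proper_connection_number G =
     (LEAST k. \<exists>c. proper_connected G c \<and> card (c ` uedges G) = k)"

text \<open>Vertices: $v = 0$ and $u_i = i$ for $1 \le i \le 6$.\<close>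

definition G1 :: "nat pair_pre_digraph" where
  "G1 = mk_symmetric (with_proj
     \<lparr> pverts = {0, 1, 2, 3, 4, 5, 6},
       parcs = {(0,1), (0,2), (0,3), (0,4), (0,5), (0,6), (1,2), (3,4), (5,6)} \<rparr>)"

text \<open>Vertices: $v = 0$, $u_1 = 1$, $u_2 = 2$ and $w_i = i + 2$ for $1 \le i \le 5$.\<close>

definition G2 :: "nat pair_pre_digraph" where
  "G2 = mk_symmetric (with_proj
     \<lparr> pverts = {0, 1, 2, 3, 4, 5, 6, 7},
       parcs = {(0,1), (0,2), (1,2), (0,3), (3,4), (3,7), (4,7), (3,5), (3,6), (5,6)} \<rparr>)"

end

theory Submission
  imports Defs
begin

text \<open>
  Orient a bipartite spanning subgraph and colour each arc by the side of its tail: every directed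
  path is then properly coloured. So two colours suffice as soon as some bipartite spanning subgraph
  has an orientation in which of any two vertices one is reachable from the other; by Robbins'
  theorem this only asks that its bridges lie on a common path.

  If \<open>\<delta> \<ge> 3\<close>, take a maximum cut. A set that is cut off by a bridge of the cut graph has at most two
  boundary edges in \<open>G\<close>, hence more than \<open>\<delta>\<close> vertices. Since \<open>n \<le> 4\<delta>\<close>, either no three such sets are
  disjoint, and the bridges lie on a path, or three of them leave a single vertex, which has another
  edge to one of them that repairs the colouring.

  If \<open>\<delta> = 2\<close>, then \<open>n \<le> 8\<close>. When \<open>G\<close> has an even cycle, a largest strongly orientable bipartite
  subgraph extends by at most two paths to all vertices. When \<open>G\<close> has no even cycle, a longest path
  is Hamiltonian or has five or six vertices, and then \<open>G\<close> is \<open>G1\<close> or \<open>G2\<close>.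
\<close>

section \<open>Directed paths as proper paths\<close>

text \<open>A maximum cut serves because it contains at least half of the boundary of every vertex
  set, not only half of all edges: this keeps the cut graph connected and allows at most one further
  edge of the graph beside each of its bridges. The obstacle is three disjoint sides of bridges:
  however the three bridges are directed, two of them both point away from their sides or both
  towards them, and these two sides are then incomparable. Three such sides use at least
  \<open>3 * (d + 1)\<close> of the at most \<open>4 * d\<close> vertices, so at most
  \<open>d - 3\<close> remain between them, and a degree count reduces these to one. For minimum
  degree two the count says nothing: a vertex of degree two with one edge in the cut is itself such
  a side. There the cut is abandoned. The split by even cycles is natural because without them every
  bipartite subgraph is a forest, and a forest can be oriented with all pairs of vertices comparable
  only if it is a path.\<close>

fun path_edges :: "'a list \<Rightarrow> 'a set list" where
  "path_edges (x # y # p) = {x, y} # path_edges (y # p)"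
| "path_edges _ = []"

lemma path_edges_append:
  "p \<noteq> [] \<Longrightarrow> q \<noteq> [] \<Longrightarrow> path_edges (p @ q) = path_edges p @ {last p, hd q} # path_edges q"
proof (induction p rule: path_edges.induct)
  case (1 x y p)
  then show ?case by simp
next
  case ("2_2" x)
  then show ?case by (cases q) auto
qed auto

lemma path_edges_snoc: "p \<noteq> [] \<Longrightarrow> path_edges (p @ [z]) = path_edges p @ [{last p, z}]"
  by (simp add: path_edges_append)

lemma path_edges_rev: "path_edges (rev p) = rev (path_edges p)"
proof (induction p rule: path_edges.induct)
  case (1 x y p)
  have "path_edges (rev (x # y # p)) = path_edges (rev (y # p) @ [x])" by simp
  also have "\<dots> = path_edges (rev (y # p)) @ [{y, x}]"
    by (subst path_edges_snoc) (auto simp: last_rev)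
  also have "\<dots> = rev (path_edges (x # y # p))" using 1 by (simp add: insert_commute)
  finally show ?case .
qed auto

lemma length_path_edges: "length (path_edges p) = length p - 1"
  by (induction p rule: path_edges.induct) auto

lemma nth_path_edges: "Suc i < length p \<Longrightarrow> path_edges p ! i = {p ! i, p ! Suc i}"
proof (induction p arbitrary: i rule: path_edges.induct)
  case (1 x y p)
  then show ?case by (cases i) auto
qed auto

lemma set_vwalk_arcs_subset:
  "successively (\<lambda>x y. (x, y) \<in> R) p \<Longrightarrow> set (vwalk_arcs p) \<subseteq> R"
  by (induction p rule: vwalk_arcs.induct) auto

lemma proper_pathI:
  assumes "p \<noteq> []" "distinct p" "set p \<subseteq> pverts G"
    and "successively (\<lambda>x y. (x, y) \<in> parcs G) p"
    and alt: "successively (\<noteq>) (map c (path_edges p))"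
  shows "proper_path G c p"
proof -
  have "c {p ! i, p ! (i + 1)} \<noteq> c {p ! (i + 1), p ! (i + 2)}" if "i + 2 < length p" for i
  proof -
    have "map c (path_edges p) ! i \<noteq> map c (path_edges p) ! Suc i"
      using alt that by (auto simp: successively_conv_nth length_path_edges)
    then show ?thesis using that by (simp add: nth_path_edges length_path_edges)
  qed
  moreover have "vpath p G"
    using assms set_vwalk_arcs_subset[of "parcs G" p] by (auto simp: vpath_def vwalk_def)
  ultimately show ?thesis by (simp add: proper_path_def)
qed

lemma successively_imp_rtrancl:
  "successively (\<lambda>x y. (x, y) \<in> D) p \<Longrightarrow> w \<in> set p \<Longrightarrow> (hd p, w) \<in> D\<^sup>* \<and> (w, last p) \<in> D\<^sup>*"
proof (induction p arbitrary: w rule: path_edges.induct)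
  case (1 x y p)
  then have IH: "(y, v) \<in> D\<^sup>* \<and> (v, last (y # p)) \<in> D\<^sup>*" if "v \<in> set (y # p)" for v
    using that by fastforce
  have "(x, y) \<in> D" using 1 by simp
  then show ?case using IH[of w] IH[of y] 1(3)
    by (auto intro: converse_rtrancl_into_rtrancl)
qed auto

text \<open>The last clause places every vertex of the path between \<open>u\<close> and
  \<open>v\<close> in reachability; it later keeps paths inside the vertex set and makes two joined
  paths disjoint. A repeated vertex is removed by cutting the path back to its earlier
  visit.\<close>

lemma rtrancl_imp_path:
  assumes "(u, v) \<in> D\<^sup>*"
  obtains p where "p \<noteq> []" "hd p = u" "last p = v" "distinct p"
    "successively (\<lambda>x y. (x, y) \<in> D) p"
    "\<And>w. w \<in> set p \<Longrightarrow> (u, w) \<in> D\<^sup>* \<and> (w, v) \<in> D\<^sup>*"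
proof -
  have "\<exists>p. p \<noteq> [] \<and> hd p = u \<and> last p = v \<and> distinct p \<and> successively (\<lambda>x y. (x, y) \<in> D) p"
    using assms
  proof (induction rule: rtrancl_induct)
    case base
    show ?case by (rule exI[of _ "[u]"]) auto
  next
    case (step y z)
    then obtain p where p: "p \<noteq> []" "hd p = u" "last p = y" "distinct p"
      "successively (\<lambda>x y. (x, y) \<in> D) p" by blast
    show ?case
    proof (cases "z \<in> set p")
      case True
      then obtain a b where ab: "p = a @ z # b" by (meson split_list)
      show ?thesis
        by (rule exI[of _ "a @ [z]"])
          (use p ab in \<open>cases a; auto simp: successively_append_iff successively_Cons hd_append split: if_splits\<close>)
    next
      case False
      show ?thesis
        by (rule exI[of _ "p @ [z]"]) (use p step False in \<open>auto simp: successively_append_iff\<close>)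
    qed
  qed
  then show thesis using that successively_imp_rtrancl by metis
qed

lemma rtrancl_field:
  assumes "(a, b) \<in> D\<^sup>*" "D \<subseteq> V \<times> V"
  shows "a \<in> V \<longleftrightarrow> b \<in> V"
  using assms by (induction rule: rtrancl_induct) auto

text \<open>Arcs are coloured by the side of their tail, so directed paths alternate. Giving a
  monochromatic edge the side of its ends makes it differ from every arc entering one of its ends.\<close>

definition tail_color :: "('a \<Rightarrow> bool) \<Rightarrow> 'a rel \<Rightarrow> 'a set \<Rightarrow> nat" where
  "tail_color f D e = of_bool (\<exists>u v. e = {u, v} \<and> ((u, v) \<in> D \<or> f u = f v) \<and> f u)"

text \<open>Opposite arcs are excluded because a colour belongs to the unordered edge, whose two
  ends lie on different sides.\<close>

definition bip_orient :: "('a \<Rightarrow> bool) \<Rightarrow> 'a rel \<Rightarrow> bool" where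
  "bip_orient f D \<longleftrightarrow> (\<forall>x y. (x, y) \<in> D \<longrightarrow> (y, x) \<notin> D \<and> f x \<noteq> f y)"

lemma tail_color_arc:
  "bip_orient f D \<Longrightarrow> (x, y) \<in> D \<Longrightarrow> tail_color f D {x, y} = of_bool (f x)"
  unfolding tail_color_def bip_orient_def by (auto simp: doubleton_eq_iff)

lemma tail_color_mono: "f x = f y \<Longrightarrow> tail_color f D {x, y} = of_bool (f x)"
  unfolding tail_color_def by (auto simp: doubleton_eq_iff)

text \<open>The head of each arc is the tail of the next, and heads and tails lie on different
  sides. The clause on the last colour drives the induction and is needed again where two directed
  paths are joined.\<close>

lemma directed_path_alternates:
  assumes "bip_orient f D" "p \<noteq> []" "successively (\<lambda>x y. (x, y) \<in> D) p"
  shows "successively (\<noteq>) (map (tail_color f D) (path_edges p)) \<and>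
    (path_edges p \<noteq> [] \<longrightarrow> tail_color f D (last (path_edges p)) = of_bool (\<not> f (last p)))"
  using assms(2,3)
proof (induction p rule: rev_nonempty_induct)
  case (snoc z p)
  then have D: "(last p, z) \<in> D" and p: "successively (\<lambda>x y. (x, y) \<in> D) p"
    by (auto simp: successively_append_iff)
  have "tail_color f D {last p, z} = of_bool (f (last p))" "f (last p) \<noteq> f z"
    using D assms(1) by (auto simp: tail_color_arc bip_orient_def)
  then show ?case using snoc(2)[OF p] snoc(1)
    by (cases "path_edges p = []") (auto simp: path_edges_snoc successively_append_iff last_map)
qed auto

lemma successively_neq_commute: "successively (\<lambda>x y. y \<noteq> x) xs = successively (\<noteq>) xs"
  by (auto elim!: successively_mono)

lemma directed_path_imp_proper_path:
  assumes "bip_orient f D" "D \<subseteq> parcs G" "parcs G \<subseteq> pverts G \<times> pverts G"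
    "(u, v) \<in> D\<^sup>*" "u \<in> pverts G"
  shows "\<exists>p. proper_path G (tail_color f D) p \<and> hd p = u \<and> last p = v"
proof -
  obtain p where p: "p \<noteq> []" "hd p = u" "last p = v" "distinct p"
    "successively (\<lambda>x y. (x, y) \<in> D) p" "\<And>w. w \<in> set p \<Longrightarrow> (u, w) \<in> D\<^sup>* \<and> (w, v) \<in> D\<^sup>*"
    using rtrancl_imp_path[OF assms(4)] by metis
  have "w \<in> pverts G" if "w \<in> set p" for w
    using p(6)[OF that] assms(2,3,5) rtrancl_field[of u w D "pverts G"] by auto
  moreover have "successively (\<lambda>x y. (x, y) \<in> parcs G) p"
    using p(5) assms(2) by (auto elim!: successively_mono)
  ultimately have "proper_path G (tail_color f D) p"
    using p directed_path_alternates[OF assms(1) p(1,5)] by (intro proper_pathI) auto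
  then show ?thesis using p by auto
qed

text \<open>Directed paths enter \<open>x\<close> and \<open>y\<close> through edges coloured
  opposite to \<open>f x\<close> and \<open>f y\<close>, whereas the edge between \<open>x\<close>
  and \<open>y\<close> has the common side as its colour. A vertex on both paths would be reachable
  from \<open>w\<close> and would reach \<open>x\<close>, which the hypothesis on
  \<open>(w, x)\<close> forbids.\<close>

lemma joined_directed_paths_imp_proper_path:
  assumes "bip_orient f D" "D \<subseteq> parcs G" "parcs G \<subseteq> pverts G \<times> pverts G" "sym (parcs G)"
    "(u, x) \<in> D\<^sup>*" "(w, y) \<in> D\<^sup>*" "(w, x) \<notin> D\<^sup>*" "(x, y) \<in> parcs G" "f x = f y"
  shows "\<exists>p. proper_path G (tail_color f D) p \<and> hd p = u \<and> last p = w"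
proof -
  obtain p where p: "p \<noteq> []" "hd p = u" "last p = x" "distinct p"
    "successively (\<lambda>x y. (x, y) \<in> D) p" "\<And>a. a \<in> set p \<Longrightarrow> (u, a) \<in> D\<^sup>* \<and> (a, x) \<in> D\<^sup>*"
    using rtrancl_imp_path[OF assms(5)] by metis
  obtain q where q: "q \<noteq> []" "hd q = w" "last q = y" "distinct q"
    "successively (\<lambda>x y. (x, y) \<in> D) q" "\<And>a. a \<in> set q \<Longrightarrow> (w, a) \<in> D\<^sup>* \<and> (a, y) \<in> D\<^sup>*"
    using rtrancl_imp_path[OF assms(6)] by metis
  have xy: "x \<in> pverts G" "y \<in> pverts G" using assms(3,8) by auto
  have *: "a \<in> pverts G" if "(a, b) \<in> D\<^sup>*" "b \<in> pverts G" for a b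
    using that assms(2,3) rtrancl_field[of a b D "pverts G"] by auto
  have "set (p @ rev q) \<subseteq> pverts G" using p(6) q(6) xy * by auto
  moreover have "distinct (p @ rev q)"
    using p(4,6) q(4,6) assms(7) by (auto intro: rtrancl_trans)
  moreover have "successively (\<lambda>x y. (x, y) \<in> parcs G) (p @ rev q)"
  proof -
    have "successively (\<lambda>x y. (x, y) \<in> parcs G) p"
      using p(5) assms(2) by (auto elim!: successively_mono)
    moreover have "successively (\<lambda>x y. (y, x) \<in> parcs G) q"
      using q(5) assms(2,4) by (auto elim!: successively_mono dest: symD)
    ultimately show ?thesis using p q assms(8)
      by (auto simp: successively_append_iff hd_rev last_rev)
  qed
  moreover have "successively (\<noteq>) (map (tail_color f D) (path_edges (p @ rev q)))"
    using directed_path_alternates[OF assms(1) p(1,5)] directed_path_alternates[OF assms(1) q(1,5)]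
      p(1,3) q(1,3) assms(9)
    by (cases "path_edges p = []"; cases "path_edges q = []")
      (auto simp: path_edges_append path_edges_rev hd_rev successively_append_iff successively_Cons
        rev_map[symmetric] successively_neq_commute last_map hd_map tail_color_mono)
  ultimately have "proper_path G (tail_color f D) (p @ rev q)"
    using p by (intro proper_pathI) auto
  then show ?thesis using p q by (intro exI[of _ "p @ rev q"]) (auto simp: last_rev)
qed

lemma proper_path_rev:
  assumes "sym (parcs G)" "proper_path G c p"
  shows "proper_path G c (rev p)"
proof -
  have p: "set p \<subseteq> pverts G" "p \<noteq> []" "distinct p"
    using assms(2) by (auto simp: proper_path_def vpath_def vwalk_def)
  have succ: "set (vwalk_arcs q) \<subseteq> R \<Longrightarrow> successively (\<lambda>x y. (x, y) \<in> R) q" for q and R :: "'a rel"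
    by (induction q rule: vwalk_arcs.induct) auto
  have "successively (\<lambda>x y. (x, y) \<in> parcs G) p"
    using assms(2) by (intro succ) (auto simp: proper_path_def vpath_def vwalk_def)
  then have "successively (\<lambda>x y. (x, y) \<in> parcs G) (rev p)"
    using assms(1) by (auto elim!: successively_mono dest: symD)
  moreover have "successively (\<noteq>) (map c (path_edges p))"
    using assms(2) by (auto simp: proper_path_def successively_conv_nth length_path_edges nth_path_edges)
  then have "successively (\<noteq>) (map c (path_edges (rev p)))"
    by (simp add: path_edges_rev rev_map[symmetric] successively_neq_commute)
  ultimately show ?thesis using p by (intro proper_pathI) auto
qed

section \<open>Bridges and orientations\<close>

definition boundary :: "'a rel \<Rightarrow> 'a set \<Rightarrow> 'a rel" where
  "boundary E S = {(x, y) \<in> E. x \<in> S \<and> y \<notin> S}"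

text \<open>Connectedness is stated through boundaries instead of walks, since the arguments below
  construct a vertex set and ask which edges leave it.\<close>

locale conn_graph =
  fixes V :: "'a set" and E :: "'a rel"
  assumes finite_V: "finite V"
    and E_subset: "E \<subseteq> V \<times> V"
    and sym_E: "sym E"
    and cut: "S \<subseteq> V \<Longrightarrow> S \<noteq> {} \<Longrightarrow> S \<noteq> V \<Longrightarrow> boundary E S \<noteq> {}"
begin

lemma E_sym: "(x, y) \<in> E \<Longrightarrow> (y, x) \<in> E"
  using sym_E by (auto dest: symD)

lemma E_in_V: "(x, y) \<in> E \<Longrightarrow> x \<in> V \<and> y \<in> V"
  using E_subset by auto

lemma finite_E: "finite E"
  using finite_V E_subset by (meson finite_SigmaI finite_subset)

text \<open>Bridges are represented by their sides, so that the tree of bridges becomes a cross-free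
  family of sets.\<close>

definition bridge_sets :: "'a set set" where
  "bridge_sets = {S. S \<subseteq> V \<and> (\<exists>x y. boundary E S = {(x, y)})}"

lemma bridge_sets_ne: "S \<in> bridge_sets \<Longrightarrow> S \<noteq> {} \<and> S \<noteq> V \<and> S \<subseteq> V"
  using E_subset by (auto simp: bridge_sets_def boundary_def)

lemma boundary_compl: "boundary E (V - S) = (boundary E (V \<inter> S))\<inverse>"
  using E_in_V E_sym unfolding boundary_def by blast

lemma bridge_sets_compl: "S \<in> bridge_sets \<Longrightarrow> V - S \<in> bridge_sets"
proof -
  assume S: "S \<in> bridge_sets"
  then obtain x y where "boundary E S = {(x, y)}" "S \<subseteq> V" by (auto simp: bridge_sets_def)
  then have "boundary E (V - S) = {(y, x)}"
    using boundary_compl[of S] by (simp add: Int_absorb1 converse_unfold) auto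
  then show ?thesis by (auto simp: bridge_sets_def)
qed

lemma bridge_set_boundary:
  "S \<in> bridge_sets \<Longrightarrow> (x, y) \<in> E \<Longrightarrow> x \<in> S \<Longrightarrow> y \<notin> S \<Longrightarrow> boundary E S = {(x, y)}"
proof -
  assume "S \<in> bridge_sets" "(x, y) \<in> E" "x \<in> S" "y \<notin> S"
  moreover from this have "(x, y) \<in> boundary E S" by (simp add: boundary_def)
  ultimately show ?thesis by (auto simp: bridge_sets_def)
qed

text \<open>If \<open>S\<close> and \<open>T\<close> crossed, each of the four corners would contain
  an end of one of the two bridges. If the bridges coincide, there are only two ends. Otherwise the
  bridge of \<open>S\<close> has both ends on one side of \<open>T\<close>, and the bridge of
  \<open>T\<close> has a single end on the other side, where there are two corners.\<close>

lemma bridge_sets_uncrossed: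
  assumes "S \<in> bridge_sets" "T \<in> bridge_sets"
  shows "S \<inter> T = {} \<or> S \<subseteq> T \<or> T \<subseteq> S \<or> S \<union> T = V"
proof (rule ccontr)
  assume neg: "\<not> ?thesis"
  have sub: "S \<subseteq> V" "T \<subseteq> V" using assms by (auto dest: bridge_sets_ne)
  obtain p q r s where S: "boundary E S = {(p, q)}" and T: "boundary E T = {(r, s)}"
    using assms by (auto simp: bridge_sets_def)
  have S1: "a = p \<and> b = q" if "(a, b) \<in> E" "a \<in> S" "b \<notin> S" for a b
    using S that by (auto simp: boundary_def)
  have T1: "a = r \<and> b = s" if "(a, b) \<in> E" "a \<in> T" "b \<notin> T" for a b
    using T that by (auto simp: boundary_def)
  have ex: "\<exists>a b. (a, b) \<in> E \<and> a \<in> Q \<and> b \<notin> Q" if "Q \<subseteq> V" "Q \<noteq> {}" "Q \<noteq> V" for Q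
    using cut[OF that] by (auto simp: boundary_def)
  obtain a1 b1 where 1: "(a1, b1) \<in> E" "a1 \<in> S" "a1 \<in> T" "b1 \<notin> S \<or> b1 \<notin> T"
    using ex[of "S \<inter> T"] neg sub by blast
  obtain a2 b2 where 2: "(a2, b2) \<in> E" "a2 \<in> S" "a2 \<notin> T" "b2 \<notin> S \<or> b2 \<in> T"
    using ex[of "S - T"] neg sub by blast
  obtain a3 b3 where 3: "(a3, b3) \<in> E" "a3 \<notin> S" "a3 \<in> T" "b3 \<in> S \<or> b3 \<notin> T"
    using ex[of "T - S"] neg sub by blast
  obtain a4 b4 where 4: "(a4, b4) \<in> E" "a4 \<notin> S" "a4 \<notin> T" "b4 \<in> S \<or> b4 \<in> T"
    using ex[of "V - (S \<union> T)"] neg sub E_in_V by blast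
  show False
  proof -
    have pq: "(p, q) \<in> E" "(q, p) \<in> E" using S E_sym unfolding boundary_def by blast+
    have "a1 = p \<and> b1 = q \<or> a1 = r \<and> b1 = s" using 1 S1 T1 by blast
    moreover have "a2 = p \<and> b2 = q \<or> a2 = s \<and> b2 = r" using 2 S1 T1 E_sym by blast
    moreover have "a3 = q \<and> b3 = p \<or> a3 = r \<and> b3 = s" using 3 S1 T1 E_sym by blast
    moreover have "a4 = q \<and> b4 = p \<or> a4 = s \<and> b4 = r" using 4 S1 T1 E_sym by blast
    ultimately show False
      using 1 2 3 4 T1[OF pq(1)] T1[OF pq(2)] by auto
  qed
qed

text \<open>If the two sets cover \<open>V\<close>, the complement of \<open>S\<close> is a bridge
  set inside \<open>S0\<close> and equals it by minimality.\<close>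

lemma minimal_bridge_set_uncrossed:
  assumes "S0 \<in> bridge_sets" "\<And>S. S \<in> bridge_sets \<Longrightarrow> \<not> S \<subset> S0" "S \<in> bridge_sets"
  shows "S0 \<subseteq> S \<or> S0 \<inter> S = {}"
proof -
  have "S \<subseteq> S0 \<Longrightarrow> S = S0" using assms(2)[OF assms(3)] by auto
  moreover have "S0 \<inter> S = {}" if "S0 \<union> S = V"
  proof -
    have "V - S \<subseteq> S0" using that by auto
    then have "V - S = S0" using assms(2)[OF bridge_sets_compl[OF assms(3)]] by auto
    then show ?thesis by auto
  qed
  ultimately show ?thesis using bridge_sets_uncrossed[OF assms(1,3)] by auto
qed

text \<open>Robbins' theorem: in a largest orientation all of whose arcs lie on directed cycles, an edge
  between different strong components can only be a bridge, as otherwise it could be added together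
  with a path that closes it to a cycle.\<close>

lemma strong_orientation:
  obtains D where "D \<subseteq> E" "\<And>x y. (x, y) \<in> D \<Longrightarrow> (y, x) \<notin> D" "sym (D\<^sup>*)"
    "\<And>x y. (x, y) \<in> E \<Longrightarrow> (x, y) \<notin> D\<^sup>* \<Longrightarrow> \<exists>S\<in>bridge_sets. boundary E S = {(x, y)}"
proof -
  define \<D> where "\<D> = {D. D \<subseteq> E \<and> (\<forall>x y. (x, y) \<in> D \<longrightarrow> (y, x) \<notin> D) \<and> sym (D\<^sup>*)}"
  have "{} \<in> \<D>" by (auto simp: \<D>_def intro!: symI)
  moreover have "\<forall>D. D \<in> \<D> \<longrightarrow> card D < Suc (card E)"
    using finite_E by (auto simp: \<D>_def less_Suc_eq_le intro: card_mono)
  ultimately obtain D where D: "D \<in> \<D>" and max: "\<And>D'. D' \<in> \<D> \<Longrightarrow> card D' \<le> card D"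
    using ex_has_greatest_nat[of "\<lambda>D. D \<in> \<D>" "{}" card] by blast
  have DE: "D \<subseteq> E" and anti: "\<And>x y. (x, y) \<in> D \<Longrightarrow> (y, x) \<notin> D" and sD: "sym (D\<^sup>*)"
    using D by (auto simp: \<D>_def)
  have "\<exists>S\<in>bridge_sets. boundary E S = {(x, y)}" if xy: "(x, y) \<in> E" "(x, y) \<notin> D\<^sup>*" for x y
  proof -
    define F where "F = E - {(x, y), (y, x)}"
    have symF: "sym F" using E_sym by (auto simp: F_def intro!: symI)
    define S where "S = F\<^sup>* `` {x}"
    have "S \<subseteq> V" using rtrancl_field[of x _ F V] E_in_V[OF xy(1)] E_subset
      by (auto simp: S_def F_def)
    show ?thesis
    proof (cases "y \<in> S")
      case False
      have "(a, b) = (x, y)" if "(a, b) \<in> E" "a \<in> S" "b \<notin> S" for a b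
      proof (rule ccontr)
        assume ab: "(a, b) \<noteq> (x, y)"
        have "(a, b) \<in> F" using that ab False by (auto simp: F_def)
        then show False using that by (auto simp: S_def intro: rtrancl_into_rtrancl)
      qed
      moreover have "x \<in> S" by (auto simp: S_def)
      ultimately have "boundary E S = {(x, y)}" using xy False unfolding boundary_def by blast
      then show ?thesis using \<open>S \<subseteq> V\<close> by (auto simp: bridge_sets_def)
    next
      case True
      then have "(y, x) \<in> F\<^sup>*" using sym_rtrancl[OF symF] by (auto simp: S_def dest: symD)
      then obtain p where p: "p \<noteq> []" "hd p = y" "last p = x" "distinct p"
        "successively (\<lambda>x y. (x, y) \<in> F) p" by (rule rtrancl_imp_path)
      \<comment> \<open>Arcs of the path inside a strong component are left out: \<open>D\<close>
        already leads from one end to the other, and adding them might reverse an arc of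
        \<open>D\<close>.\<close>
      define A where "A = {(p ! i, p ! Suc i) | i. Suc i < length p \<and> (p ! i, p ! Suc i) \<notin> D\<^sup>*}"
      define D' where "D' = insert (x, y) (D \<union> A)"
      have AF: "A \<subseteq> F" using p(5) by (auto simp: A_def successively_conv_nth)
      have A_anti: "(b, a) \<notin> A" if "(a, b) \<in> A" for a b
        using that p(4) by (auto simp: A_def nth_eq_iff_index_eq)
      have A_notin: "(a, b) \<notin> D\<^sup>*" "(b, a) \<notin> D\<^sup>*" if "(a, b) \<in> A" for a b
        using that sD by (auto simp: A_def dest: symD)
      have D_notin: "(x, y) \<notin> D" "(y, x) \<notin> D" using xy sD by (auto dest: symD)
      have "D' \<subseteq> E" using DE AF xy by (auto simp: D'_def F_def)
      moreover have "(b, a) \<notin> D'" if "(a, b) \<in> D'" for a b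
        using that A_anti A_notin D_notin anti AF xy unfolding D'_def F_def by blast
      moreover have "sym (D'\<^sup>*)"
      proof -
        have DD': "D\<^sup>* \<subseteq> D'\<^sup>*" by (intro rtrancl_mono) (auto simp: D'_def)
        have "(p ! i, p ! Suc i) \<in> D'\<^sup>*" if "Suc i < length p" for i
          using that DD' by (cases "(p ! i, p ! Suc i) \<in> D\<^sup>*") (auto simp: D'_def A_def)
        then have "successively (\<lambda>x y. (x, y) \<in> D'\<^sup>*) p"
          by (auto simp: successively_conv_nth)
        from successively_imp_rtrancl[OF this]
        have on_p: "(y, a) \<in> D'\<^sup>* \<and> (a, x) \<in> D'\<^sup>*" if "a \<in> set p" for a
          using that p by auto
        have xyD': "(x, y) \<in> D'" by (simp add: D'_def)
        have ret: "(b, a) \<in> D'\<^sup>*" if abD': "(a, b) \<in> D'" for a b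
        proof -
          consider "(a, b) = (x, y)" | "(a, b) \<in> D" | "(a, b) \<in> A" using abD' by (auto simp: D'_def)
          then show ?thesis
          proof cases
            case 1
            moreover have "x \<in> set p" using p(1,3) by auto
            ultimately show ?thesis using on_p[of x] by simp
          next
            case 2
            then have "(b, a) \<in> D\<^sup>*" using sD by (auto dest: symD)
            then show ?thesis using DD' by blast
          next
            case 3
            then have "a \<in> set p" "b \<in> set p" by (auto simp: A_def)
            then have "(b, x) \<in> D'\<^sup>*" "(y, a) \<in> D'\<^sup>*" using on_p by auto
            then show ?thesis using xyD' by (meson converse_rtrancl_into_rtrancl rtrancl_trans)
          qed
        qed
        have "(b, a) \<in> D'\<^sup>*" if "(a, b) \<in> D'\<^sup>*" for a b
          using that by (induction rule: rtrancl_induct) (auto intro: rtrancl_trans ret)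
        then show ?thesis by (auto intro: symI)
      qed
      ultimately have "D' \<in> \<D>" unfolding \<D>_def by blast
      moreover have "card D < card D'"
      proof (rule psubset_card_mono)
        show "finite D'" using finite_E \<open>D' \<subseteq> E\<close> by (rule finite_subset[rotated])
        show "D \<subset> D'" using D_notin by (auto simp: D'_def)
      qed
      ultimately show ?thesis using max[of D'] by simp
    qed
  qed
  then show thesis using DE anti sD that by blast
qed

end

section \<open>Orientations whose strong components are separated by bridges\<close>

locale oriented_conn_graph = conn_graph +
  fixes D :: "'a rel"
  assumes D_subset: "D \<subseteq> E"
    and D_anti: "(x, y) \<in> D \<Longrightarrow> (y, x) \<notin> D"
    and D_sym: "sym (D\<^sup>*)"
    and not_D_bridge: "(x, y) \<in> E \<Longrightarrow> (x, y) \<notin> D\<^sup>* \<Longrightarrow> \<exists>S\<in>bridge_sets. boundary E S = {(x, y)}"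
begin

text \<open>An arc across the bridge needs a directed way back, and the only way back is the
  opposite arc, excluded by \<open>D_anti\<close>.\<close>

lemma D_not_crossing:
  assumes "S \<in> bridge_sets" "(x, y) \<in> D"
  shows "x \<in> S \<longleftrightarrow> y \<in> S"
proof -
  have *: False if T: "T \<in> bridge_sets" and xy: "x \<in> T" "y \<notin> T" for T
  proof -
    have T1: "boundary E T = {(x, y)}"
      using bridge_set_boundary[OF T] xy assms(2) D_subset by auto
    have "(y, x) \<in> D\<^sup>*" using assms(2) D_sym by (auto dest: symD)
    then have "x \<notin> T"
    proof (induction rule: rtrancl_induct)
      case base
      then show ?case using xy by simp
    next
      case (step a b)
      show ?case
      proof
        assume "b \<in> T"
        then have "(b, a) = (x, y)"
          using step T1 D_subset E_sym by (auto simp: boundary_def)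
        then show False using step(2) assms(2) D_anti by auto
      qed
    qed
    then show False using xy by simp
  qed
  have "x \<in> V" "y \<in> V" using assms(2) D_subset E_in_V by auto
  then show ?thesis using *[OF assms(1)] *[OF bridge_sets_compl[OF assms(1)]] by auto
qed

lemma D_rtrancl_not_crossing:
  assumes "S \<in> bridge_sets" "(x, y) \<in> D\<^sup>*"
  shows "x \<in> S \<longleftrightarrow> y \<in> S"
  using assms(2)
proof (induction rule: rtrancl_induct)
  case (step y z)
  then show ?case using D_not_crossing[OF assms(1) step(2)] by simp
qed simp

text \<open>An edge that leaves a strong component inside \<open>L\<close> would be a bridge with a
  side splitting \<open>L\<close>, which minimality rules out. So the component holds the only edge
  leaving \<open>L\<close>, and the rest of \<open>L\<close> would have an empty boundary.\<close>

lemma minimal_bridge_set_strong: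
  assumes "L \<in> bridge_sets" "\<And>S. S \<in> bridge_sets \<Longrightarrow> \<not> S \<subset> L" "x \<in> L" "y \<in> L"
  shows "(x, y) \<in> D\<^sup>*"
proof -
  define X where "X = D\<^sup>* `` {x}"
  have XL: "X \<subseteq> L" using D_rtrancl_not_crossing[OF assms(1)] assms(3) by (auto simp: X_def)
  have LV: "L \<subseteq> V" "L \<noteq> V" using bridge_sets_ne[OF assms(1)] by auto
  have out: "b \<notin> L" if ab: "(a, b) \<in> E" "a \<in> X" "b \<notin> X" for a b
  proof
    assume "b \<in> L"
    have "(a, b) \<notin> D\<^sup>*" using ab by (auto simp: X_def intro: rtrancl_trans)
    then obtain S where S: "S \<in> bridge_sets" "boundary E S = {(a, b)}"
      using not_D_bridge ab by blast
    then have "a \<in> S" "b \<notin> S" by (auto simp: boundary_def)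
    then show False
      using minimal_bridge_set_uncrossed[OF assms(1,2) S(1)] \<open>b \<in> L\<close> ab(2) XL by auto
  qed
  have "x \<in> X" by (auto simp: X_def)
  then have "boundary E X \<noteq> {}" using cut XL LV by (metis empty_iff order_trans subset_antisym)
  then obtain a b where ab: "(a, b) \<in> E" "a \<in> X" "b \<notin> X" by (auto simp: boundary_def)
  have bL: "boundary E L = {(a, b)}"
    using bridge_set_boundary[OF assms(1) ab(1)] ab(2) out[OF ab] XL by auto
  have "boundary E (L - X) = {}"
  proof (rule equals0I)
    fix e assume "e \<in> boundary E (L - X)"
    then obtain c d where cd: "e = (c, d)" "(c, d) \<in> E" "c \<in> L" "c \<notin> X" "d \<notin> L \<or> d \<in> X"
      by (auto simp: boundary_def)
    show False
    proof (cases "d \<in> X")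
      case True
      then show ?thesis using out[of d c] cd E_sym by auto
    next
      case False
      then have "(c, d) \<in> boundary E L" using cd by (auto simp: boundary_def)
      then show ?thesis using bL ab cd by auto
    qed
  qed
  then have "L - X = {}" using cut[of "L - X"] LV by auto
  then show ?thesis using assms(4) by (auto simp: X_def)
qed

text \<open>All bridges are directed away from a minimal bridge set; the absence of three disjoint
  bridge sets makes the sides containing it a chain.\<close>

lemma unilateral_orientation:
  assumes no3: "\<And>S T U. S \<in> bridge_sets \<Longrightarrow> T \<in> bridge_sets \<Longrightarrow> U \<in> bridge_sets \<Longrightarrow>
      S \<inter> T = {} \<Longrightarrow> S \<inter> U = {} \<Longrightarrow> T \<inter> U = {} \<Longrightarrow> False"
  shows "\<exists>D'. D' \<subseteq> E \<and> (\<forall>x y. (x, y) \<in> D' \<longrightarrow> (y, x) \<notin> D') \<and>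
    (\<forall>u\<in>V. \<forall>v\<in>V. (u, v) \<in> D'\<^sup>* \<or> (v, u) \<in> D'\<^sup>*)"
proof (cases "bridge_sets = {}")
  case True
  have "(u, v) \<in> D\<^sup>*" if "u \<in> V" "v \<in> V" for u v
  proof (rule ccontr)
    assume uv: "(u, v) \<notin> D\<^sup>*"
    have "D\<^sup>* `` {u} \<subseteq> V"
      using rtrancl_field[of u _ D V] D_subset E_subset that by auto
    then have "boundary E (D\<^sup>* `` {u}) \<noteq> {}" using cut[of "D\<^sup>* `` {u}"] uv that by blast
    then obtain a b where "(a, b) \<in> E" "(u, a) \<in> D\<^sup>*" "(u, b) \<notin> D\<^sup>*" by (auto simp: boundary_def)
    then show False using not_D_bridge True by (metis empty_iff rtrancl_trans)
  qed
  then show ?thesis using D_subset D_anti by (intro exI[of _ D]) blast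
next
  case False
  have "finite bridge_sets"
    using finite_V by (auto simp: bridge_sets_def intro: finite_subset[of _ "Pow V"])
  then obtain S0 where S0: "S0 \<in> bridge_sets" and min0: "\<And>S. S \<in> bridge_sets \<Longrightarrow> \<not> S \<subset> S0"
    using False finite_has_minimal by (metis psubset_eq)
  define B where "B = {S \<in> bridge_sets. S0 \<subseteq> S}"
  define D' where "D' = D \<union> \<Union> (boundary E ` B)"
  have S0_ne: "S0 \<noteq> {}" using S0 bridge_sets_ne by auto
  have side: "S \<in> B \<or> V - S \<in> B" if "S \<in> bridge_sets" for S
    using minimal_bridge_set_uncrossed[OF S0 min0 that] bridge_sets_compl[OF that] that
      bridge_sets_ne[OF S0] by (auto simp: B_def)
  have Bb: "\<exists>x y. boundary E T = {(x, y)}" if "T \<in> B" for T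
    using that by (auto simp: B_def bridge_sets_def)
  have cross: "(a, b) \<in> boundary E T" if "T \<in> B" "(a, b) \<in> D'" "a \<in> T" "b \<notin> T" for a b T
    using that D_subset by (auto simp: boundary_def D'_def)
  \<comment> \<open>If \<open>T\<close> and \<open>T'\<close> covered \<open>V\<close>, their
    complements and \<open>S0\<close> would be three disjoint bridge sets.\<close>
  have B_nested: "T \<subseteq> T' \<or> T' \<subseteq> T" if "T \<in> B" "T' \<in> B" for T T'
  proof -
    have TT: "T \<in> bridge_sets" "T' \<in> bridge_sets" "S0 \<subseteq> T" "S0 \<subseteq> T'" using that by (auto simp: B_def)
    have "T \<union> T' \<noteq> V"
    proof
      assume "T \<union> T' = V"
      then have "(V - T) \<inter> (V - T') = {}" by auto
      then show False
        using no3[OF S0 bridge_sets_compl[OF TT(1)] bridge_sets_compl[OF TT(2)]] TT(3,4) by auto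
    qed
    then show ?thesis using bridge_sets_uncrossed[OF TT(1,2)] TT S0_ne by auto
  qed
  have "D' \<subseteq> E" using D_subset by (auto simp: D'_def boundary_def)
  moreover have "(y, x) \<notin> D'" if xy: "(x, y) \<in> D'" for x y
  proof
    assume yx: "(y, x) \<in> D'"
    have nc: "\<not> ((a, b) \<in> D \<and> (a \<in> T \<longleftrightarrow> b \<notin> T))" if "T \<in> B" for a b T
      using that D_not_crossing[of T a b] by (auto simp: B_def)
    obtain T T' where T: "T \<in> B" "(x, y) \<in> boundary E T" "T' \<in> B" "(y, x) \<in> boundary E T'"
      using xy yx nc D_anti[of x y] unfolding D'_def boundary_def by blast
    then show False using B_nested[OF T(1,3)] by (auto simp: boundary_def)
  qed
  moreover have sep: "\<exists>T\<in>B. u \<notin> T \<and> v \<in> T" if uv: "(u, v) \<notin> D'\<^sup>*" "u \<in> V" "v \<in> V" for u v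
  proof (rule ccontr)
    assume neg: "\<not> ?thesis"
    define R where "R = D'\<^sup>* `` {u}"
    \<comment> \<open>Add to \<open>R\<close> all that lies behind a bridge directed into
      \<open>R\<close> and does not contain \<open>v\<close>. The result contains \<open>u\<close>
      but not \<open>v\<close>, and the two cases below show that no edge leaves it.\<close>
    define X where "X = R \<union> \<Union> {T \<in> B. v \<notin> T \<and> (\<exists>a b. boundary E T = {(a, b)} \<and> b \<in> R)}"
    have RV: "R \<subseteq> V" using rtrancl_field[of u _ D' V] \<open>D' \<subseteq> E\<close> E_subset uv by (auto simp: R_def)
    have "X \<subseteq> V" using RV bridge_sets_ne by (auto simp: X_def B_def)
    moreover have "u \<in> X" "v \<notin> X" using uv by (auto simp: X_def R_def)
    ultimately obtain a b where ab: "(a, b) \<in> E" "a \<in> X" "b \<notin> X"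
      using cut[of X] uv by (auto simp: boundary_def)
    have bR: "b \<notin> R" using ab by (auto simp: X_def)
    show False
    proof (cases "a \<in> R")
      case True
      have nD': "(a, b) \<notin> D'" using True bR by (auto simp: R_def intro: rtrancl_into_rtrancl)
      have "(a, b) \<notin> D\<^sup>*"
      proof
        assume "(a, b) \<in> D\<^sup>*"
        then have "(a, b) \<in> D'\<^sup>*" using rtrancl_mono[of D D'] by (auto simp: D'_def)
        then show False using True bR by (auto simp: R_def intro: rtrancl_trans)
      qed
      then obtain S where S: "S \<in> bridge_sets" "boundary E S = {(a, b)}"
        using not_D_bridge ab by blast
      then have "S \<notin> B" using nD' by (auto simp: D'_def)
      then have T: "V - S \<in> B" using side S by auto
      have bT: "boundary E (V - S) = {(b, a)}"
        using boundary_compl[of S] S bridge_sets_ne[OF S(1)] by (auto simp: Int_absorb1)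
      then have b_in: "b \<in> V - S" "a \<notin> V - S" by (auto simp: boundary_def)
      have "v \<in> V - S"
      proof (rule ccontr)
        assume "v \<notin> V - S"
        then have "V - S \<subseteq> X" using T bT True by (auto simp: X_def)
        then show False using b_in ab by auto
      qed
      then have "u \<in> V - S" using neg T by auto
      \<comment> \<open>A directed walk from \<open>u\<close> leaves \<open>V - S\<close> only
        through its bridge and so visits \<open>b\<close> first.\<close>
      have "w \<in> V - S \<or> b \<in> R" if "(u, w) \<in> D'\<^sup>*" for w
        using that
      proof (induction rule: rtrancl_induct)
        case base
        then show ?case using \<open>u \<in> V - S\<close> by simp
      next
        case (step y z)
        show ?case
        proof (cases "y \<in> V - S \<and> z \<notin> V - S")
          case True
          then have "(y, z) = (b, a)" using cross[OF T step(2)] bT by auto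
          then show ?thesis using step by (auto simp: R_def)
        next
          case False
          then show ?thesis using step by auto
        qed
      qed
      then show False using True b_in bR by (auto simp: R_def)
    next
      case False
      then obtain T c d where T: "T \<in> B" "v \<notin> T" "boundary E T = {(c, d)}" "d \<in> R" "a \<in> T" "T \<subseteq> X"
        using ab(2) unfolding X_def by blast
      have "(a, b) \<in> boundary E T" using T ab by (auto simp: boundary_def)
      then show False using T bR by auto
    qed
  qed
  \<comment> \<open>Failure in both directions would give two members of \<open>B\<close> neither of
    which contains the other.\<close>
  moreover have "(u, v) \<in> D'\<^sup>* \<or> (v, u) \<in> D'\<^sup>*" if "u \<in> V" "v \<in> V" for u v
    using sep[of u v] sep[of v u] that B_nested by blast
  ultimately show ?thesis by (intro exI[of _ D']) blast
qed

end

section \<open>Minimum degree at least three\<close>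

text \<open>An upper bound only; that one colour is not enough is shown in
  \<open>two_le_card_colors\<close>.\<close>

definition two_proper_connected :: "'a set \<Rightarrow> 'a rel \<Rightarrow> bool" where
  "two_proper_connected V E \<longleftrightarrow>
     (\<exists>c. proper_connected \<lparr>pverts = V, parcs = E\<rparr> c \<and> range c \<subseteq> {0, 1})"

text \<open>Every arc starting in \<open>X\<close> leaves \<open>X\<close> or is one of the
  \<open>card X * (card X - 1)\<close> ordered pairs of distinct vertices of
  \<open>X\<close>.\<close>

lemma card_boundary_le:
  assumes "E \<subseteq> V \<times> V" "finite V" "X \<subseteq> V" "\<And>x. (x, x) \<notin> E"
    "\<And>x. x \<in> V \<Longrightarrow> d \<le> card (E `` {x})"
  shows "d * card X \<le> card (boundary E X) + card X * (card X - 1)"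
proof -
  have finX: "finite X" and finE: "finite E"
    using assms by (auto intro: finite_subset)
  have "d * card X = (\<Sum>x\<in>X. d)" by simp
  also have "\<dots> \<le> (\<Sum>x\<in>X. card (E `` {x}))" using assms by (intro sum_mono) auto
  also have "\<dots> = card (SIGMA x:X. E `` {x})"
    using finX finE by (subst card_SigmaI) auto
  also have "\<dots> \<le> card (boundary E X \<union> (X \<times> X - Id_on X))"
    using finX finE assms(4)
    by (intro card_mono) (auto simp: boundary_def intro: finite_subset[of _ E])
  also have "\<dots> \<le> card (boundary E X) + card (X \<times> X - Id_on X)" by (rule card_Un_le)
  also have "card (X \<times> X - Id_on X) = card X * (card X - 1)"
  proof -
    have "Id_on X = (\<lambda>x. (x, x)) ` X" by auto
    then have "card (Id_on X) = card X" by (simp add: card_image inj_on_def)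
    then show ?thesis
      using finX by (subst card_Diff_subset) (auto simp: card_cartesian_product diff_mult_distrib2
          intro: finite_subset[of _ "X \<times> X"])
  qed
  finally show ?thesis by simp
qed

section \<open>Two-colourings from orientations, maximum cuts and minimal bridge sets\<close>

context conn_graph
begin

text \<open>The third alternative serves pairs that are incomparable in \<open>D\<close>: a
  monochromatic edge links the ends of two directed paths.\<close>

lemma two_proper_connectedI:
  assumes "bip_orient f D" "D \<subseteq> E"
    "\<And>u v. u \<in> V \<Longrightarrow> v \<in> V \<Longrightarrow> (u, v) \<in> D\<^sup>* \<or> (v, u) \<in> D\<^sup>* \<or>
      (\<exists>s t x y. {u, v} = {s, t} \<and> (s, x) \<in> D\<^sup>* \<and> (t, y) \<in> D\<^sup>* \<and> (t, x) \<notin> D\<^sup>* \<and> (x, y) \<in> E \<and> f x = f y)"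
  shows "two_proper_connected V E"
proof -
  let ?G = "\<lparr>pverts = V, parcs = E\<rparr>"
  let ?P = "\<lambda>u v. \<exists>p. proper_path ?G (tail_color f D) p \<and> hd p = u \<and> last p = v"
  have rev: "?P v u" if uv: "?P u v" for u v
  proof -
    obtain p where p: "proper_path ?G (tail_color f D) p" "hd p = u" "last p = v" using uv by blast
    have "proper_path ?G (tail_color f D) (rev p)" using proper_path_rev[OF _ p(1)] sym_E by simp
    moreover have "p \<noteq> []" using p(1) by (auto simp: proper_path_def vpath_def vwalk_def)
    ultimately show ?thesis using p by (intro exI[of _ "rev p"]) (auto simp: hd_rev last_rev)
  qed
  have "?P u v" if uv: "u \<in> V" "v \<in> V" for u v
  proof -
    have dir: "?P s t" if "(s, t) \<in> D\<^sup>*" "s \<in> V" for s t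
      using directed_path_imp_proper_path[OF assms(1), of ?G] that assms(2) E_subset by simp
    consider "(u, v) \<in> D\<^sup>*" | "(v, u) \<in> D\<^sup>*"
      | s t x y where "{u, v} = {s, t}" "(s, x) \<in> D\<^sup>*" "(t, y) \<in> D\<^sup>*" "(t, x) \<notin> D\<^sup>*" "(x, y) \<in> E" "f x = f y"
      using assms(3)[OF uv] by blast
    then show ?thesis
    proof cases
      case 1
      then show ?thesis using dir uv by blast
    next
      case 2
      then show ?thesis using dir rev uv by blast
    next
      case 3
      then have "?P s t"
        using joined_directed_paths_imp_proper_path[OF assms(1), of ?G s x t y] assms(2) E_subset sym_E
        by simp
      then show ?thesis using 3(1) rev by (auto simp: doubleton_eq_iff)
    qed
  qed
  then have "proper_connected ?G (tail_color f D)" by (auto simp: proper_connected_def)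
  moreover have "range (tail_color f D) \<subseteq> {0, 1}" by (auto simp: tail_color_def)
  ultimately show ?thesis unfolding two_proper_connected_def by blast
qed

text \<open>Switching the side of every vertex of \<open>S\<close> exchanges cut and uncut edges on
  the boundary of \<open>S\<close> and affects no other edge, so in a largest cut the cut edges
  cannot be the minority there.\<close>

lemma max_cut:
  obtains f :: "'a \<Rightarrow> bool" where
    "\<And>S. card (boundary {(x, y) \<in> E. f x = f y} S) \<le> card (boundary {(x, y) \<in> E. f x \<noteq> f y} S)"
proof -
  let ?C = "\<lambda>f :: 'a \<Rightarrow> bool. {(x, y) \<in> E. f x \<noteq> f y}"
  let ?M = "\<lambda>f :: 'a \<Rightarrow> bool. {(x, y) \<in> E. f x = f y}"
  have fin: "finite A" if "A \<subseteq> E" for A using finite_E that by (rule finite_subset[rotated])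
  have "\<forall>f. card (?C f) < Suc (card E)"
    using finite_E by (auto simp: less_Suc_eq_le intro!: card_mono)
  then obtain f where f: "\<And>g. card (?C g) \<le> card (?C f)"
    using ex_has_greatest_nat[of "\<lambda>_. True" undefined "\<lambda>f. card (?C f)"] by blast
  have "card (boundary (?M f) S) \<le> card (boundary (?C f) S)" for S
  proof -
    define g where "g x = (if x \<in> S then \<not> f x else f x)" for x
    define c where "c = boundary (?C f) S"
    define m where "m = boundary (?M f) S"
    have finc: "finite c" "finite m" unfolding c_def m_def by (auto intro!: fin simp: boundary_def)
    have "card (c \<union> c\<inverse>) = card c + card c"
      using finc by (subst card_Un_disjoint) (auto simp: c_def boundary_def)
    moreover have "card (m \<union> m\<inverse>) = card m + card m"
      using finc by (subst card_Un_disjoint) (auto simp: m_def boundary_def)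
    moreover have "?C g \<union> (c \<union> c\<inverse>) = ?C f \<union> (m \<union> m\<inverse>)"
      using E_sym by (auto simp: g_def c_def m_def boundary_def split: if_splits)
    moreover have "?C g \<inter> (c \<union> c\<inverse>) = {}" "?C f \<inter> (m \<union> m\<inverse>) = {}"
      by (auto simp: g_def c_def m_def boundary_def)
    moreover have "finite (?C g)" "finite (?C f)" by (auto intro!: fin)
    ultimately have "card (?C g) + (card c + card c) = card (?C f) + (card m + card m)"
      using card_Un_disjoint[of "?C g" "c \<union> c\<inverse>"] card_Un_disjoint[of "?C f" "m \<union> m\<inverse>"] finc
      by simp
    then show ?thesis using f[of g] by (simp add: c_def m_def)
  qed
  then show thesis by (rule that)
qed

lemma minimal_bridge_subset:
  assumes "S \<in> bridge_sets"
  obtains L where "L \<in> bridge_sets" "L \<subseteq> S" "\<And>T. T \<in> bridge_sets \<Longrightarrow> \<not> T \<subset> L"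
proof -
  obtain L where L: "L \<in> bridge_sets \<and> L \<subseteq> S"
    and least: "\<And>T. T \<in> bridge_sets \<and> T \<subseteq> S \<Longrightarrow> card L \<le> card T"
    using ex_has_least_nat[of "\<lambda>L. L \<in> bridge_sets \<and> L \<subseteq> S" S card] assms by auto
  have "finite L" using L finite_V bridge_sets_ne by (auto intro: finite_subset)
  have "\<not> T \<subset> L" if "T \<in> bridge_sets" for T
  proof
    assume T: "T \<subset> L"
    then have "card L \<le> card T" using least[of T] L that by auto
    then show False using psubset_card_mono[OF \<open>finite L\<close> T] by simp
  qed
  then show thesis using L that by blast
qed

text \<open>Otherwise a single edge would be the bridge of both \<open>A\<close> and
  \<open>B\<close>, nothing would leave their union, and connectedness would leave no room for
  \<open>C\<close>.\<close>

lemma bridge_end_notin: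
  assumes "A \<in> bridge_sets" "B \<in> bridge_sets" "C \<noteq> {}" "C \<subseteq> V"
    "A \<inter> B = {}" "A \<inter> C = {}" "B \<inter> C = {}" "boundary E A = {(x, y)}"
  shows "y \<notin> B"
proof
  assume "y \<in> B"
  have xy: "(x, y) \<in> E" "x \<in> A" using assms(8) unfolding boundary_def by blast+
  then have "boundary E B = {(y, x)}"
    using bridge_set_boundary[OF assms(2) E_sym[OF xy(1)]] \<open>y \<in> B\<close> assms(5) by blast
  then have "boundary E (A \<union> B) = {}"
    using assms(8) xy(2) \<open>y \<in> B\<close> unfolding boundary_def by blast
  moreover have "A \<union> B \<subseteq> V" "A \<union> B \<noteq> {}" "A \<union> B \<noteq> V"
    using assms bridge_sets_ne by blast+
  ultimately show False using cut by blast
qed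

end

context oriented_conn_graph
begin

text \<open>Three strong sets hang on \<open>v\<close> by bridges, and a further edge of the host graph \<open>F\<close> joins
  \<open>v\<close> to a vertex of \<open>A\<close> on its own side. Directing everything from \<open>A\<close> and \<open>B\<close> through \<open>v\<close> to \<open>C\<close>
  leaves only \<open>A\<close> and \<open>B\<close> to be linked, which the further edge does.\<close>

lemma three_strong_sets:
  fixes f :: "'a \<Rightarrow> bool"
  assumes F: "conn_graph V F" "E = {(x, y) \<in> F. f x \<noteq> f y}"
    and A: "A \<in> bridge_sets" "\<And>S. S \<in> bridge_sets \<Longrightarrow> \<not> S \<subset> A" "boundary E A = {(a, v)}"
    and B: "B \<in> bridge_sets" "\<And>S. S \<in> bridge_sets \<Longrightarrow> \<not> S \<subset> B" "boundary E B = {(b, v)}"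
    and C: "C \<in> bridge_sets" "\<And>S. S \<in> bridge_sets \<Longrightarrow> \<not> S \<subset> C" "boundary E C = {(c, v)}"
    and disj: "A \<inter> B = {}" "A \<inter> C = {}" "B \<inter> C = {}"
    and V: "V = insert v (A \<union> B \<union> C)"
    and x: "x \<in> A" "(x, v) \<in> F" "f x = f v"
  shows "two_proper_connected V F"
proof -
  have mem: "a \<in> A" "b \<in> B" "c \<in> C" "v \<notin> A" "v \<notin> B" "v \<notin> C" "(a, v) \<in> E" "(b, v) \<in> E" "(c, v) \<in> E"
    using A(3) B(3) C(3) unfolding boundary_def by blast+
  define D' where "D' = D \<union> {(a, v), (b, v), (v, c)}"
  have D'E: "D' \<subseteq> E" using D_subset mem E_sym by (auto simp: D'_def)
  \<comment> \<open>No arc of \<open>D\<close> crosses a bridge set and \<open>v\<close> is the only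
    vertex outside the three sets, so \<open>v\<close> is isolated in \<open>D\<close>. Hence the
    three new arcs oppose no arc of \<open>D\<close>.\<close>
  have vD: "(v, y) \<notin> D" "(y, v) \<notin> D" for y
  proof -
    have "y \<notin> A \<union> B \<union> C" if "(v, y) \<in> D \<or> (y, v) \<in> D"
      using that mem D_not_crossing[OF A(1), of y v] D_not_crossing[OF A(1), of v y]
        D_not_crossing[OF B(1), of y v] D_not_crossing[OF B(1), of v y]
        D_not_crossing[OF C(1), of y v] D_not_crossing[OF C(1), of v y] by auto
    then have "y = v" if "(v, y) \<in> D \<or> (y, v) \<in> D"
      using that D_subset E_in_V V by blast
    then show "(v, y) \<notin> D" "(y, v) \<notin> D" using D_anti by blast+
  qed
  have "bip_orient f D'"
    unfolding bip_orient_def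
  proof (intro allI impI conjI)
    fix s t assume st: "(s, t) \<in> D'"
    then show "f s \<noteq> f t" using D'E F(2) by auto
    show "(t, s) \<notin> D'" using st vD D_anti mem disj by (auto simp: D'_def)
  qed
  have DD': "(s, t) \<in> D'\<^sup>*" if "(s, t) \<in> D\<^sup>*" for s t
    using that rtrancl_mono[of D D'] by (auto simp: D'_def)
  have strong: "(s, t) \<in> D'\<^sup>*" if "s \<in> A \<and> t \<in> A \<or> s \<in> B \<and> t \<in> B \<or> s \<in> C \<and> t \<in> C" for s t
    using that minimal_bridge_set_strong[OF A(1,2), of s t] minimal_bridge_set_strong[OF B(1,2), of s t]
      minimal_bridge_set_strong[OF C(1,2), of s t] DD' by auto
  have arcs: "(a, v) \<in> D'" "(b, v) \<in> D'" "(v, c) \<in> D'" by (auto simp: D'_def)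
  have to_v: "(s, v) \<in> D'\<^sup>*" if "s \<in> A \<union> B" for s
    using that strong[of s a] strong[of s b] mem arcs by (auto intro: rtrancl_into_rtrancl)
  have from_v: "(v, t) \<in> D'\<^sup>*" if "t \<in> C" for t
    using that strong[of c t] mem arcs by (auto intro: converse_rtrancl_into_rtrancl)
  have thru_v: "(s, t) \<in> D'\<^sup>*" if "s \<in> A \<union> B" "t \<in> C" for s t
    using to_v from_v that by (meson rtrancl_trans)
  \<comment> \<open>No arc of \<open>D'\<close> enters \<open>A\<close>, so a vertex of
    \<open>B\<close> cannot reach \<open>x\<close>; this is the disjointness condition for joining
    paths from \<open>A\<close> and \<open>B\<close>.\<close>
  have closed: "t \<notin> A" if "(s, t) \<in> D'\<^sup>*" "s \<notin> A" for s t
    using that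
  proof (induction rule: rtrancl_induct)
    case (step y z)
    then show ?case using D_not_crossing[OF A(1), of y z] mem disj by (auto simp: D'_def)
  qed
  interpret F: conn_graph V F by fact
  show ?thesis
  proof (rule F.two_proper_connectedI[OF \<open>bip_orient f D'\<close>])
    show "D' \<subseteq> F" using D'E F(2) by auto
    fix s t assume st: "s \<in> V" "t \<in> V"
    have join: "\<exists>x y. (s, x) \<in> D'\<^sup>* \<and> (t, y) \<in> D'\<^sup>* \<and> (t, x) \<notin> D'\<^sup>* \<and> (x, y) \<in> F \<and> f x = f y"
      if "s \<in> A" "t \<in> B" for s t
      using strong[of s x] to_v[of t] closed[of t x] x that disj by blast
    consider "s \<in> A" "t \<in> B" | "t \<in> A" "s \<in> B" | "(s, t) \<in> D'\<^sup>* \<or> (t, s) \<in> D'\<^sup>*"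
      using st V strong to_v from_v thru_v by blast
    then show "(s, t) \<in> D'\<^sup>* \<or> (t, s) \<in> D'\<^sup>* \<or>
      (\<exists>s' t' x y. {s, t} = {s', t'} \<and> (s', x) \<in> D'\<^sup>* \<and> (t', y) \<in> D'\<^sup>* \<and> (t', x) \<notin> D'\<^sup>* \<and>
        (x, y) \<in> F \<and> f x = f y)"
    proof cases
      case 1
      then show ?thesis using join[of s t] by blast
    next
      case 2
      have "{s, t} = {t, s}" by auto
      then show ?thesis using join[OF 2] by blast
    qed auto
  qed
qed

end

lemma two_proper_connected_min_degree_ge_3:
  assumes "conn_graph V E" and irrefl: "\<And>x. (x, x) \<notin> E"
    and deg: "\<And>x. x \<in> V \<Longrightarrow> d \<le> card (E `` {x})" and d: "3 \<le> d" "card V \<le> 4 * d"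
  shows "two_proper_connected V E"
proof -
  interpret conn_graph V E by fact
  obtain f :: "'a \<Rightarrow> bool" where
    f: "\<And>S. card (boundary {(x, y) \<in> E. f x = f y} S) \<le> card (boundary {(x, y) \<in> E. f x \<noteq> f y} S)"
    using max_cut by blast
  define H where "H = {(x, y) \<in> E. f x \<noteq> f y}"
  define N where "N = {(x, y) \<in> E. f x = f y}"
  have HN: "boundary E S = boundary H S \<union> boundary N S" for S
    by (auto simp: boundary_def H_def N_def)
  have fin: "finite (boundary H S)" "finite (boundary N S)" for S
    using finite_E by (auto simp: boundary_def H_def N_def intro: finite_subset[of _ E])
  have N_le: "card (boundary N S) \<le> card (boundary H S)" for S
    using f by (simp add: H_def N_def)
  interpret H: conn_graph V H
  proof
    show "finite V" "H \<subseteq> V \<times> V" "sym H"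
      using finite_V E_subset E_sym by (auto simp: H_def intro!: symI)
    fix S assume S: "S \<subseteq> V" "S \<noteq> {}" "S \<noteq> V"
    show "boundary H S \<noteq> {}" using cut[OF S] HN[of S] N_le[of S] fin[of S] by auto
  qed
  obtain D where D: "D \<subseteq> H" "\<And>x y. (x, y) \<in> D \<Longrightarrow> (y, x) \<notin> D" "sym (D\<^sup>*)"
    "\<And>x y. (x, y) \<in> H \<Longrightarrow> (x, y) \<notin> D\<^sup>* \<Longrightarrow> \<exists>S\<in>H.bridge_sets. boundary H S = {(x, y)}"
    using H.strong_orientation by blast
  interpret O: oriented_conn_graph V H D by unfold_locales (fact D)+
  show ?thesis
  proof (cases "\<exists>S T U. S \<in> H.bridge_sets \<and> T \<in> H.bridge_sets \<and> U \<in> H.bridge_sets \<and>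
      S \<inter> T = {} \<and> S \<inter> U = {} \<and> T \<inter> U = {}")
    case False
    then obtain D' where D': "D' \<subseteq> H" "\<And>x y. (x, y) \<in> D' \<Longrightarrow> (y, x) \<notin> D'"
      "\<And>u v. u \<in> V \<Longrightarrow> v \<in> V \<Longrightarrow> (u, v) \<in> D'\<^sup>* \<or> (v, u) \<in> D'\<^sup>*"
      using O.unilateral_orientation by metis
    have "bip_orient f D'" using D'(1,2) by (auto simp: bip_orient_def H_def)
    then show ?thesis
      by (rule two_proper_connectedI) (use D'(1,3) in \<open>auto simp: H_def\<close>)
  next
    case True
    then obtain S T U where STU: "S \<in> H.bridge_sets" "T \<in> H.bridge_sets" "U \<in> H.bridge_sets"
      "S \<inter> T = {}" "S \<inter> U = {}" "T \<inter> U = {}" by blast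
    obtain A where A: "A \<in> H.bridge_sets" "A \<subseteq> S" "\<And>T. T \<in> H.bridge_sets \<Longrightarrow> \<not> T \<subset> A"
      using H.minimal_bridge_subset[OF STU(1)] by blast
    obtain B where B: "B \<in> H.bridge_sets" "B \<subseteq> T" "\<And>T. T \<in> H.bridge_sets \<Longrightarrow> \<not> T \<subset> B"
      using H.minimal_bridge_subset[OF STU(2)] by blast
    obtain C where C: "C \<in> H.bridge_sets" "C \<subseteq> U" "\<And>T. T \<in> H.bridge_sets \<Longrightarrow> \<not> T \<subset> C"
      using H.minimal_bridge_subset[OF STU(3)] by blast
    have disj: "A \<inter> B = {}" "A \<inter> C = {}" "B \<inter> C = {}" using A(2) B(2) C(2) STU(4-6) by auto
    have ne: "A \<noteq> {}" "B \<noteq> {}" "C \<noteq> {}" "A \<subseteq> V" "B \<subseteq> V" "C \<subseteq> V"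
      using A(1) B(1) C(1) H.bridge_sets_ne by blast+
    have finS: "finite A" "finite B" "finite C"
      using ne finite_V by (auto intro: finite_subset)
    \<comment> \<open>One edge in the cut and, by the choice of \<open>f\<close>, at most one
      outside it.\<close>
    have bd_le: "card (boundary E L) \<le> 2" if L: "L \<in> H.bridge_sets" for L
    proof -
      have "card (boundary H L) = 1" using L by (auto simp: H.bridge_sets_def)
      then show ?thesis using HN[of L] N_le[of L] card_Un_le[of "boundary H L" "boundary N L"] by simp
    qed
    \<comment> \<open>If \<open>card L \<le> d\<close>, the positive factors \<open>card L\<close>
      and \<open>d - card L + 1\<close> have sum \<open>d + 1 \<ge> 4\<close>, so their product is
      at least 3, whereas the degree count bounds it by 2. This is where degree two fails.\<close>
    have big: "d + 1 \<le> card L" if L: "L \<in> H.bridge_sets" for L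
    proof (rule ccontr)
      assume "\<not> ?thesis"
      then obtain k where k: "d = card L + k" using le_Suc_ex[of "card L" d] by auto
      have LV: "L \<subseteq> V" "L \<noteq> {}" using H.bridge_sets_ne[OF L] by auto
      then have "card L > 0" using finite_V by (metis card_gt_0_iff finite_subset)
      then obtain m where m: "card L = Suc m" using gr0_implies_Suc by blast
      have "d * card L \<le> 2 + card L * (card L - 1)"
        using card_boundary_le[OF E_subset finite_V LV(1) irrefl deg] bd_le[OF L] by simp
      then have "(1 + k) * Suc m \<le> 2" using k m by (simp add: algebra_simps)
      then show False using d(1) k m by (simp add: algebra_simps)
    qed
    define M where "M = V - (A \<union> B \<union> C)"
    have "V = (A \<union> B \<union> C) \<union> M" using ne(4-6) by (auto simp: M_def)
    moreover have "(A \<union> B \<union> C) \<inter> M = {}" "finite M" using finite_V by (auto simp: M_def)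
    ultimately have "card V = card (A \<union> B \<union> C) + card M"
      using finS card_Un_disjoint[of "A \<union> B \<union> C" M] by simp
    moreover have "card (A \<union> B \<union> C) = card A + card B + card C"
      using finS disj by (simp add: card_Un_disjoint Int_Un_distrib2)
    ultimately have M_le: "card M + 3 \<le> d"
      using big[OF A(1)] big[OF B(1)] big[OF C(1)] d(2) by linarith
    obtain a va where a: "boundary H A = {(a, va)}" using A(1) by (auto simp: H.bridge_sets_def)
    obtain b vb where b: "boundary H B = {(b, vb)}" using B(1) by (auto simp: H.bridge_sets_def)
    obtain c vc where c: "boundary H C = {(c, vc)}" using C(1) by (auto simp: H.bridge_sets_def)
    have "va \<in> M"
    proof -
      have "va \<in> V" "va \<notin> A" using a H.E_in_V unfolding boundary_def by blast+
      moreover have "va \<notin> B" "va \<notin> C"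
        using H.bridge_end_notin[OF A(1) B(1) ne(3,6)] H.bridge_end_notin[OF A(1) C(1) ne(2,5)]
          disj a by blast+
      ultimately show ?thesis by (simp add: M_def)
    qed
    have "vb \<in> M"
    proof -
      have "vb \<in> V" "vb \<notin> B" using b H.E_in_V unfolding boundary_def by blast+
      moreover have "vb \<notin> A" "vb \<notin> C"
        using H.bridge_end_notin[OF B(1) A(1) ne(3,6)] H.bridge_end_notin[OF B(1) C(1) ne(1,4)]
          disj b by blast+
      ultimately show ?thesis by (simp add: M_def)
    qed
    have "vc \<in> M"
    proof -
      have "vc \<in> V" "vc \<notin> C" using c H.E_in_V unfolding boundary_def by blast+
      moreover have "vc \<notin> A" "vc \<notin> B"
        using H.bridge_end_notin[OF C(1) A(1) ne(2,5)] H.bridge_end_notin[OF C(1) B(1) ne(1,4)]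
          disj c by blast+
      ultimately show ?thesis by (simp add: M_def)
    qed
    \<comment> \<open>Two edges for each of the three sets give the bound 6. With
      \<open>card M + 3 \<le> d\<close> the degree count becomes \<open>4 * card M \<le> 6\<close>,
      so \<open>M\<close> is a single vertex.\<close>
    have "boundary E M \<subseteq> (boundary E A)\<inverse> \<union> (boundary E B)\<inverse> \<union> (boundary E C)\<inverse>"
      using E_sym E_in_V unfolding boundary_def M_def by blast
    then have "card (boundary E M) \<le> card ((boundary E A)\<inverse> \<union> (boundary E B)\<inverse> \<union> (boundary E C)\<inverse>)"
      using fin HN by (intro card_mono) auto
    also have "\<dots> \<le> card ((boundary E A)\<inverse>) + card ((boundary E B)\<inverse>) + card ((boundary E C)\<inverse>)"
      by (meson add_mono card_Un_le le_refl order_trans)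
    also have "\<dots> \<le> 6" using bd_le[OF A(1)] bd_le[OF B(1)] bd_le[OF C(1)] by (simp add: card_inverse)
    finally have "card (boundary E M) \<le> 6" .
    then have "d * card M \<le> 6 + card M * (card M - 1)"
      using card_boundary_le[OF E_subset finite_V _ irrefl deg, of M] by (simp add: M_def)
    moreover obtain k where "d = card M + 3 + k" using M_le le_Suc_ex by blast
    moreover have "card M > 0"
      using \<open>va \<in> M\<close> finite_V by (auto simp: card_gt_0_iff M_def)
    then obtain m where m: "card M = Suc m" using gr0_implies_Suc by blast
    ultimately have "(4 + k) * Suc m \<le> 6" by (simp add: algebra_simps)
    then have "m = 0" by (simp add: algebra_simps)
    then obtain v where M: "M = {v}" using m card_1_singletonE by auto
    then have v: "va = v" "vb = v" "vc = v" using \<open>va \<in> M\<close> \<open>vb \<in> M\<close> \<open>vc \<in> M\<close> by auto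
    have V: "V = insert v (A \<union> B \<union> C)" "v \<notin> A \<union> B \<union> C" using M ne(4-6) unfolding M_def by blast+
    \<comment> \<open>At most three edges at \<open>v\<close> are in the cut, but
      \<open>card M + 3 \<le> d\<close> gives \<open>v\<close> at least four, so some edge at
      \<open>v\<close> is monochromatic.\<close>
    have "H `` {v} \<subseteq> {a, b, c}"
    proof
      fix y assume "y \<in> H `` {v}"
      then have y: "(v, y) \<in> H" by auto
      then have "y \<in> A \<union> B \<union> C" using V H.E_in_V irrefl by (auto simp: H_def)
      then have "(y, v) \<in> boundary H A \<union> boundary H B \<union> boundary H C"
        using V(2) H.E_sym[OF y] by (auto simp: boundary_def)
      then show "y \<in> {a, b, c}" using a b c by auto
    qed
    then have "card (H `` {v}) \<le> card {a, b, c}" by (intro card_mono) auto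
    also have "\<dots> \<le> 3" using card_length[of "[a, b, c]"] by simp
    also have "3 < card (E `` {v})" using deg[of v] V(1) M_le M by simp
    finally have "\<not> E `` {v} \<subseteq> H `` {v}"
      using card_mono[of "H `` {v}" "E `` {v}"] finite_subset[OF \<open>H `` {v} \<subseteq> {a, b, c}\<close>] by auto
    then obtain x where x: "(v, x) \<in> E" "f x = f v" by (auto simp: H_def)
    then have x': "(x, v) \<in> E" "x \<in> A \<union> B \<union> C" using E_sym E_in_V V irrefl by blast+
    note abc = a[unfolded v(1)] b[unfolded v(2)] c[unfolded v(3)]
    have E: "conn_graph V E" by fact
    consider "x \<in> A" | "x \<in> B" | "x \<in> C" using x'(2) by auto
    then show ?thesis
    proof cases
      case 1
      show ?thesis
        by (rule O.three_strong_sets[OF E H_def A(1,3) abc(1) B(1,3) abc(2) C(1,3) abc(3) disj V(1) 1 x'(1) x(2)])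
    next
      case 2
      show ?thesis
        by (rule O.three_strong_sets[OF E H_def B(1,3) abc(2) A(1,3) abc(1) C(1,3) abc(3) _ disj(3,2) _ 2 x'(1) x(2)])
          (use disj V in auto)
    next
      case 3
      show ?thesis
        by (rule O.three_strong_sets[OF E H_def C(1,3) abc(3) A(1,3) abc(1) B(1,3) abc(2) _ _ disj(1) _ 3 x'(1) x(2)])
          (use disj V in auto)
    qed
  qed
qed

section \<open>Strong bipartite subgraphs\<close>

context conn_graph
begin

definition strong_on :: "('a \<Rightarrow> bool) \<Rightarrow> 'a rel \<Rightarrow> 'a set \<Rightarrow> bool" where
  "strong_on f D S \<longleftrightarrow> S \<subseteq> V \<and> bip_orient f D \<and> D \<subseteq> E \<inter> S \<times> S \<and> (\<forall>x\<in>S. \<forall>y\<in>S. (x, y) \<in> D\<^sup>*)"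

text \<open>The ends are recorded because a new vertex can be attached behind \<open>t\<close> or in
  front of \<open>s\<close> without losing comparability.\<close>

definition chain :: "'a set \<Rightarrow> 'a \<Rightarrow> 'a \<Rightarrow> bool" where
  "chain W s t \<longleftrightarrow> s \<in> W \<and> t \<in> W \<and> (\<exists>f D. bip_orient f D \<and> D \<subseteq> E \<inter> W \<times> W \<and>
     (\<forall>x\<in>W. (s, x) \<in> D\<^sup>* \<and> (x, t) \<in> D\<^sup>*) \<and> (\<forall>x\<in>W. \<forall>y\<in>W. (x, y) \<in> D\<^sup>* \<or> (y, x) \<in> D\<^sup>*))"

lemma strong_on_imp_chain: "strong_on f D S \<Longrightarrow> s \<in> S \<Longrightarrow> t \<in> S \<Longrightarrow> chain S s t"
  unfolding strong_on_def chain_def by blast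

lemma chain_singleton: "chain {v} v v"
  unfolding chain_def bip_orient_def by auto

lemma chain_V: "chain V s t \<Longrightarrow> two_proper_connected V E"
proof -
  assume "chain V s t"
  then obtain f D where D: "bip_orient f D" "D \<subseteq> E"
    "\<And>x y. x \<in> V \<Longrightarrow> y \<in> V \<Longrightarrow> (x, y) \<in> D\<^sup>* \<or> (y, x) \<in> D\<^sup>*"
    unfolding chain_def by blast
  show ?thesis by (rule two_proper_connectedI[OF D(1,2)]) (use D(3) in blast)
qed

lemma bip_orient_insert:
  assumes "bip_orient f D" "D \<subseteq> W \<times> W" "z \<notin> W" "t \<in> W"
  shows "bip_orient (f(z := \<not> f t)) (insert (t, z) D)" "bip_orient (f(z := \<not> f t)) (insert (z, t) D)"
proof -
  have *: "(x, y) \<in> D \<Longrightarrow> (y, x) \<notin> D \<and> f x \<noteq> f y \<and> x \<noteq> z \<and> y \<noteq> z" for x y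
    using assms by (auto simp: bip_orient_def)
  have "t \<noteq> z" using assms by auto
  then show "bip_orient (f(z := \<not> f t)) (insert (t, z) D)" "bip_orient (f(z := \<not> f t)) (insert (z, t) D)"
    unfolding bip_orient_def by (auto dest: *)
qed

lemma chain_snoc:
  assumes "chain W s t" "(t, z) \<in> E" "z \<notin> W"
  shows "chain (insert z W) s z"
proof -
  obtain f D where D: "bip_orient f D" "D \<subseteq> E \<inter> W \<times> W" "s \<in> W" "t \<in> W"
    "\<And>x. x \<in> W \<Longrightarrow> (s, x) \<in> D\<^sup>* \<and> (x, t) \<in> D\<^sup>*" "\<And>x y. x \<in> W \<Longrightarrow> y \<in> W \<Longrightarrow> (x, y) \<in> D\<^sup>* \<or> (y, x) \<in> D\<^sup>*"
    using assms(1) unfolding chain_def by blast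
  let ?D = "insert (t, z) D"
  have sub: "D\<^sup>* \<subseteq> ?D\<^sup>*" by (intro rtrancl_mono) auto
  have "(x, z) \<in> ?D\<^sup>*" if "x \<in> W" for x
  proof -
    have "(x, t) \<in> ?D\<^sup>*" using D(5)[OF that] sub by auto
    then show ?thesis by (rule rtrancl_into_rtrancl) simp
  qed
  moreover have "bip_orient (f(z := \<not> f t)) ?D"
    using bip_orient_insert(1)[OF D(1) _ assms(3) D(4)] D(2) by auto
  moreover have "?D \<subseteq> E \<inter> insert z W \<times> insert z W" using D(2,4) assms by auto
  moreover have "\<forall>x\<in>insert z W. (s, x) \<in> ?D\<^sup>* \<and> (x, z) \<in> ?D\<^sup>*"
    using calculation(1) D(3,5) sub by auto
  moreover have "\<forall>x\<in>insert z W. \<forall>y\<in>insert z W. (x, y) \<in> ?D\<^sup>* \<or> (y, x) \<in> ?D\<^sup>*"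
    using calculation(1) D(6) sub by blast
  ultimately show ?thesis unfolding chain_def using D(3) by blast
qed

lemma chain_cons:
  assumes "chain W s t" "(s, z) \<in> E" "z \<notin> W"
  shows "chain (insert z W) z t"
proof -
  obtain f D where D: "bip_orient f D" "D \<subseteq> E \<inter> W \<times> W" "s \<in> W" "t \<in> W"
    "\<And>x. x \<in> W \<Longrightarrow> (s, x) \<in> D\<^sup>* \<and> (x, t) \<in> D\<^sup>*" "\<And>x y. x \<in> W \<Longrightarrow> y \<in> W \<Longrightarrow> (x, y) \<in> D\<^sup>* \<or> (y, x) \<in> D\<^sup>*"
    using assms(1) unfolding chain_def by blast
  let ?D = "insert (z, s) D"
  have sub: "D\<^sup>* \<subseteq> ?D\<^sup>*" by (intro rtrancl_mono) auto
  have "(z, x) \<in> ?D\<^sup>*" if "x \<in> W" for x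
  proof -
    have "(s, x) \<in> ?D\<^sup>*" using D(5)[OF that] sub by auto
    then show ?thesis by (rule converse_rtrancl_into_rtrancl[rotated]) simp
  qed
  moreover have "bip_orient (f(z := \<not> f s)) ?D"
    using bip_orient_insert(2)[OF D(1) _ assms(3) D(3)] D(2) by auto
  moreover have "?D \<subseteq> E \<inter> insert z W \<times> insert z W" using D(2,3) assms E_sym by auto
  moreover have "\<forall>x\<in>insert z W. (z, x) \<in> ?D\<^sup>* \<and> (x, t) \<in> ?D\<^sup>*"
    using calculation(1) D(4,5) sub by auto
  moreover have "\<forall>x\<in>insert z W. \<forall>y\<in>insert z W. (x, y) \<in> ?D\<^sup>* \<or> (y, x) \<in> ?D\<^sup>*"
    using calculation(1) D(6) sub by blast
  ultimately show ?thesis unfolding chain_def using D(4) by blast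
qed

lemma chain_append:
  "chain W s t \<Longrightarrow> successively (\<lambda>x y. (x, y) \<in> E) (t # p) \<Longrightarrow> distinct p \<Longrightarrow> set p \<inter> W = {} \<Longrightarrow>
    chain (W \<union> set p) s (last (t # p))"
proof (induction p arbitrary: W t)
  case (Cons z p)
  have "chain (insert z W) s z" using Cons.prems by (intro chain_snoc[of W s t]) auto
  from Cons.IH[OF this] Cons.prems show ?case by (auto simp: Un_commute)
qed auto

lemma chain_prepend:
  "chain W s t \<Longrightarrow> successively (\<lambda>x y. (x, y) \<in> E) (s # p) \<Longrightarrow> distinct p \<Longrightarrow> set p \<inter> W = {} \<Longrightarrow>
    chain (W \<union> set p) (last (s # p)) t"
proof (induction p arbitrary: W s)
  case (Cons z p)
  have "chain (insert z W) z t" using Cons.prems by (intro chain_cons[of W s t]) auto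
  from Cons.IH[OF this] Cons.prems show ?case by (auto simp: Un_commute)
qed auto

text \<open>Any two vertices of a strong set are the ends of a chain, so one path is directed into
  \<open>S\<close> and the other out of it. The choice \<open>s = t\<close> and empty paths are
  allowed.\<close>

lemma two_paths_from_strong:
  assumes "strong_on f D S" "s \<in> S" "t \<in> S"
    "successively (\<lambda>x y. (x, y) \<in> E) (s # p)" "successively (\<lambda>x y. (x, y) \<in> E) (t # q)"
    "distinct (p @ q)" "set (p @ q) \<inter> S = {}" "V = S \<union> set p \<union> set q"
  shows "two_proper_connected V E"
proof -
  have "chain (S \<union> set p) (last (s # p)) t"
    using assms by (intro chain_prepend strong_on_imp_chain[of f D]) auto
  then have "chain (S \<union> set p \<union> set q) (last (s # p)) (last (t # q))"
    using assms by (intro chain_append) auto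
  then show ?thesis using assms(8) chain_V by simp
qed

text \<open>An ear of length two keeps the subgraph bipartite exactly when its ends lie on the same
  side.\<close>

lemma strong_on_ear:
  assumes S: "strong_on f D S" and ab: "a \<in> S" "b \<in> S" "a \<noteq> b" "f a = f b"
    and z: "z \<notin> S" "(z, a) \<in> E" "(z, b) \<in> E"
  shows "strong_on (f(z := \<not> f a)) (insert (a, z) (insert (z, b) D)) (insert z S)"
proof -
  have D: "S \<subseteq> V" "bip_orient f D" "D \<subseteq> E \<inter> S \<times> S" "\<And>x y. x \<in> S \<Longrightarrow> y \<in> S \<Longrightarrow> (x, y) \<in> D\<^sup>*"
    using S by (auto simp: strong_on_def)
  let ?D = "insert (a, z) (insert (z, b) D)"
  have sub: "D\<^sup>* \<subseteq> ?D\<^sup>*" by (intro rtrancl_mono) auto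
  have "(x, z) \<in> ?D\<^sup>*" "(z, x) \<in> ?D\<^sup>*" if "x \<in> S" for x
  proof -
    have "(x, a) \<in> ?D\<^sup>*" "(b, x) \<in> ?D\<^sup>*" using D(4) that ab sub by auto
    then show "(x, z) \<in> ?D\<^sup>*" "(z, x) \<in> ?D\<^sup>*"
      by (auto intro: rtrancl_into_rtrancl converse_rtrancl_into_rtrancl)
  qed
  moreover have "bip_orient (f(z := \<not> f a)) ?D"
    using D(2,3) z ab by (auto simp: bip_orient_def)
  ultimately show ?thesis
    using D z ab sub E_in_V E_sym by (auto simp: strong_on_def)
qed

text \<open>The sides are named explicitly because an ear is later attached to such a cycle.\<close>

lemma strong_on_cycle4:
  assumes "distinct [a, b, c, d]" "(a, b) \<in> E" "(b, c) \<in> E" "(c, d) \<in> E" "(d, a) \<in> E"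
  shows "\<exists>D. strong_on (\<lambda>x. x \<in> {a, c}) D {a, b, c, d}"
proof -
  let ?D = "{(a, b), (b, c), (c, d), (d, a)}"
  have "(a, b) \<in> ?D\<^sup>*" "(b, c) \<in> ?D\<^sup>*" "(c, d) \<in> ?D\<^sup>*" "(d, a) \<in> ?D\<^sup>*" by auto
  then have "(a, x) \<in> ?D\<^sup>* \<and> (x, a) \<in> ?D\<^sup>*" if "x \<in> {a, b, c, d}" for x
    using that by (elim insertE) (blast intro: rtrancl_trans rtrancl.rtrancl_refl)+
  then have "\<forall>x\<in>{a, b, c, d}. \<forall>y\<in>{a, b, c, d}. (x, y) \<in> ?D\<^sup>*" by (meson rtrancl_trans)
  moreover have "bip_orient (\<lambda>x. x \<in> {a, c}) ?D" using assms by (auto simp: bip_orient_def)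
  moreover have "{a, b, c, d} \<subseteq> V" using assms E_in_V by blast
  ultimately show ?thesis using assms unfolding strong_on_def by blast
qed

lemma strong_on_cycle6:
  assumes "distinct [a, b, c, d, e, f]" "(a, b) \<in> E" "(b, c) \<in> E" "(c, d) \<in> E" "(d, e) \<in> E"
    "(e, f) \<in> E" "(f, a) \<in> E"
  shows "\<exists>g D. strong_on g D {a, b, c, d, e, f}"
proof -
  let ?D = "{(a, b), (b, c), (c, d), (d, e), (e, f), (f, a)}"
  have 1: "(a, b) \<in> ?D\<^sup>*" "(b, c) \<in> ?D\<^sup>*" "(c, d) \<in> ?D\<^sup>*" "(d, e) \<in> ?D\<^sup>*" "(e, f) \<in> ?D\<^sup>*" "(f, a) \<in> ?D\<^sup>*" by auto
  then have 2: "(a, c) \<in> ?D\<^sup>*" "(a, d) \<in> ?D\<^sup>*" "(a, e) \<in> ?D\<^sup>*" "(a, f) \<in> ?D\<^sup>*"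
    by (meson rtrancl_trans)+
  have 3: "(e, a) \<in> ?D\<^sup>*" "(d, a) \<in> ?D\<^sup>*" "(c, a) \<in> ?D\<^sup>*" "(b, a) \<in> ?D\<^sup>*"
    using 1 by (meson rtrancl_trans)+
  have "(a, x) \<in> ?D\<^sup>* \<and> (x, a) \<in> ?D\<^sup>*" if "x \<in> {a, b, c, d, e, f}" for x
    using that 1 2 3 by (elim insertE) simp_all
  then have "\<forall>x\<in>{a, b, c, d, e, f}. \<forall>y\<in>{a, b, c, d, e, f}. (x, y) \<in> ?D\<^sup>*" by (meson rtrancl_trans)
  moreover have "bip_orient (\<lambda>x. x \<in> {a, c, e}) ?D" using assms by (auto simp: bip_orient_def)
  moreover have "{a, b, c, d, e, f} \<subseteq> V" using assms E_in_V by blast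
  moreover have "?D \<subseteq> E" using assms by auto
  ultimately have "strong_on (\<lambda>x. x \<in> {a, c, e}) ?D {a, b, c, d, e, f}"
    unfolding strong_on_def by blast
  then show ?thesis by blast
qed

text \<open>Strong connectedness gives \<open>x\<close> an arc in and an arc out, whose other ends
  differ because opposite arcs are excluded.\<close>

lemma strong_on_two_neighbours:
  assumes "strong_on f D S" "x \<in> S" "card S \<ge> 2"
  obtains y z where "y \<in> S" "z \<in> S" "y \<noteq> z" "(x, y) \<in> E" "(x, z) \<in> E" "f y \<noteq> f x" "f z \<noteq> f x"
proof -
  have D: "S \<subseteq> V" "bip_orient f D" "D \<subseteq> E \<inter> S \<times> S" "\<And>x y. x \<in> S \<Longrightarrow> y \<in> S \<Longrightarrow> (x, y) \<in> D\<^sup>*"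
    using assms(1) by (auto simp: strong_on_def)
  have "\<not> S \<subseteq> {x}" using assms(3) card_mono[of "{x}" S] by auto
  then obtain w where w: "w \<in> S" "w \<noteq> x" by auto
  obtain y where y: "(x, y) \<in> D" using D(4)[OF assms(2) w(1)] w(2) by (auto elim: converse_rtranclE)
  obtain z where z: "(z, x) \<in> D" using D(4)[OF w(1) assms(2)] w(2) by (auto elim: rtranclE)
  have "y \<noteq> z" using y z D(2) by (auto simp: bip_orient_def)
  moreover have "f y \<noteq> f x" "f z \<noteq> f x" using y z D(2) by (auto simp: bip_orient_def)
  ultimately show thesis using that[of y z] y z D(3) E_sym by blast
qed

text \<open>Every vertex has two neighbours on the other side, so both sides have at least two
  vertices and one has exactly two. The vertices opposite to these two are adjacent to both, which
  gives K_{2,2} or K_{2,3}.\<close>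

lemma strong_on_card_4_5:
  assumes S: "strong_on f D S" and card: "4 \<le> card S" "card S \<le> 5"
  obtains p q Y where "p \<noteq> q" "p \<notin> Y" "q \<notin> Y" "S = {p, q} \<union> Y" "card Y = card S - 2" "f p = f q"
    "\<And>r. r \<in> Y \<Longrightarrow> (p, r) \<in> E \<and> (q, r) \<in> E \<and> f r \<noteq> f p"
proof -
  have finS: "finite S" using S finite_V by (auto simp: strong_on_def intro: finite_subset)
  have two_le: "2 \<le> card S" using card by simp
  define side where "side b = {x \<in> S. f x = b}" for b
  have fin: "finite (side b)" for b using finS by (simp add: side_def)
  have ge2: "2 \<le> card (side b)" for b
  proof -
    have two: "2 \<le> card (side (\<not> f x))" if x: "x \<in> S" for x
    proof -
      obtain y z where "y \<in> S" "z \<in> S" "y \<noteq> z" "(x, y) \<in> E" "(x, z) \<in> E" "f y \<noteq> f x" "f z \<noteq> f x"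
        by (rule strong_on_two_neighbours[OF S x two_le])
      then have "{y, z} \<subseteq> side (\<not> f x)" "card {y, z} = 2" by (auto simp: side_def)
      then show ?thesis using card_mono[OF fin] by metis
    qed
    obtain x where x: "x \<in> S" using card by fastforce
    show ?thesis
    proof (cases "f x = b")
      case True
      then have "side (\<not> b) \<noteq> {}" using two[OF x] by auto
      then obtain y where "y \<in> S" "f y = (\<not> b)" by (auto simp: side_def)
      then show ?thesis using two[of y] by simp
    next
      case False
      then show ?thesis using two[OF x] by simp
    qed
  qed
  have "S = side True \<union> side False" "side True \<inter> side False = {}" by (auto simp: side_def)
  then have sum: "card S = card (side True) + card (side False)"
    using fin card_Un_disjoint by metis
  then have "card (side True) = 2 \<or> card (side False) = 2"
    using ge2[of True] ge2[of False] card by linarith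
  then obtain b where b: "card (side b) = 2" by blast
  then obtain p q where pq: "side b = {p, q}" "p \<noteq> q" by (auto simp: card_2_iff)
  have cY: "card (side (\<not> b)) = card S - 2" using sum b by (cases b) auto
  have adj: "(p, r) \<in> E \<and> (q, r) \<in> E \<and> f r \<noteq> f p" if r: "r \<in> side (\<not> b)" for r
  proof -
    have rS: "r \<in> S" "f r \<noteq> b" using r by (auto simp: side_def)
    obtain y z where yz: "y \<in> S" "z \<in> S" "y \<noteq> z" "(r, y) \<in> E" "(r, z) \<in> E" "f y \<noteq> f r" "f z \<noteq> f r"
      by (rule strong_on_two_neighbours[OF S rS(1) two_le])
    then have "y \<in> side b" "z \<in> side b" using rS(2) by (auto simp: side_def)
    then have "{y, z} = {p, q}" using pq yz(3) by auto
    moreover have "p \<in> side b" using pq by auto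
    ultimately show ?thesis using yz(4,5) E_sym rS(2) by (auto simp: side_def doubleton_eq_iff)
  qed
  have "p \<in> side b" "q \<in> side b" using pq by auto
  then have "f p = f q" "p \<notin> side (\<not> b)" "q \<notin> side (\<not> b)" by (auto simp: side_def)
  moreover have "S = {p, q} \<union> side (\<not> b)" using pq by (auto simp: side_def)
  ultimately show thesis using that[of p q "side (\<not> b)"] pq(2) cY adj by blast
qed

end

section \<open>Small graphs with an even cycle\<close>

context conn_graph
begin

text \<open>If \<open>x1 = x2\<close>, the other vertex of \<open>{p, q}\<close> links
  \<open>y1\<close> to \<open>y2\<close> and closes a 6-cycle through \<open>z1\<close> and
  \<open>z2\<close>. If \<open>x1\<close> and \<open>x2\<close> differ, the edges from
  \<open>y1\<close> to \<open>x2\<close> and from \<open>y2\<close> to \<open>x1\<close> close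
  it.\<close>

lemma strong_on_hexagon:
  assumes pq: "p \<noteq> q" "p \<notin> Y" "q \<notin> Y" "\<And>r. r \<in> Y \<Longrightarrow> (p, r) \<in> E \<and> (q, r) \<in> E"
    and z: "z1 \<noteq> z2" "z1 \<notin> {p, q} \<union> Y" "z2 \<notin> {p, q} \<union> Y"
    and x: "x1 \<in> {p, q}" "x2 \<in> {p, q}" "(z1, x1) \<in> E" "(z2, x2) \<in> E"
    and y: "y1 \<in> Y" "y2 \<in> Y" "y1 \<noteq> y2" "(z1, y1) \<in> E" "(z2, y2) \<in> E"
  shows "\<exists>g D S. strong_on g D S \<and> card S = 6"
proof -
  define o1 where "o1 = (if x1 = p then q else p)"
  have adj: "(x, r) \<in> E" "(r, x) \<in> E" if "x \<in> {p, q}" "r \<in> Y" for x r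
    using that pq(4)[of r] E_sym by auto
  have o1: "o1 \<in> {p, q}" "o1 \<noteq> x1" using x pq by (auto simp: o1_def)
  show ?thesis
  proof (cases "x1 = x2")
    case True
    have d: "distinct [x1, z1, y1, o1, y2, z2]" using pq(1-3) x(1) y o1 z by auto
    have "\<exists>g D. strong_on g D {x1, z1, y1, o1, y2, z2}"
      using d x y o1 E_sym adj True by (intro strong_on_cycle6) auto
    moreover have "card {x1, z1, y1, o1, y2, z2} = 6" using distinct_card[OF d] by simp
    ultimately show ?thesis by blast
  next
    case False
    have d: "distinct [x1, z1, y1, x2, z2, y2]" using pq(1-3) x(1,2) y z False by auto
    have "\<exists>g D. strong_on g D {x1, z1, y1, x2, z2, y2}"
      using d x y E_sym adj by (intro strong_on_cycle6) auto
    moreover have "card {x1, z1, y1, x2, z2, y2} = 6" using distinct_card[OF d] by simp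
    ultimately show ?thesis by blast
  qed
qed

end

text \<open>\<open>other_neighbour\<close> is minimum degree two in the form in which it is used: no
  single vertex \<open>y\<close> exhausts the neighbours of \<open>x\<close>. Eight is four times
  this degree.\<close>

locale small_graph = conn_graph +
  assumes irrefl: "(x, x) \<notin> E"
    and other_neighbour: "x \<in> V \<Longrightarrow> \<exists>z. (x, z) \<in> E \<and> z \<noteq> y"
    and card_V: "card V \<le> 8"
begin

text \<open>The vertices outside a largest strong set \<open>S\<close> are covered by two disjoint paths starting at
  \<open>S\<close>, except when at least two of them have all their neighbours in \<open>S\<close>; then \<open>S\<close> spans a
  \<open>K\<^sub>2\<^sub>,\<^sub>2\<close> or \<open>K\<^sub>2\<^sub>,\<^sub>3\<close> and a 4-cycle through two of these vertices takes over the role of \<open>S\<close>.\<close>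

lemma two_proper_connected_even_cycle:
  assumes S: "strong_on f D S" and card_S: "4 \<le> card S"
    and max: "\<And>g F T. strong_on g F T \<Longrightarrow> card T \<le> card S"
  shows "two_proper_connected V E"
proof (rule ccontr)
  assume NG: "\<not> two_proper_connected V E"
  define R where "R = V - S"
  have SV: "S \<subseteq> V" "finite S" using S finite_V by (auto simp: strong_on_def intro: finite_subset)
  have finR: "finite R" using finite_V by (simp add: R_def)
  have cardVR: "card V = card S + card R"
    using SV finite_V by (simp add: R_def card_Diff_subset card_mono)
  let ?path = "successively (\<lambda>x y. (x, y) \<in> E)"
  have cover: False if "s \<in> S" "t \<in> S" "?path (s # p)" "?path (t # q)" "distinct (p @ q)"
    "set (p @ q) \<subseteq> R" "length (p @ q) = card R" for s t p q
  proof -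
    have "set (p @ q) = R" using that(5-7) finR by (metis card_subset_eq distinct_card)
    then have "V = S \<union> set p \<union> set q" "set (p @ q) \<inter> S = {}" using SV by (auto simp: R_def)
    then show False using two_paths_from_strong[OF S that(1-5)] NG by blast
  qed
  define adj where "adj r \<longleftrightarrow> (\<exists>s\<in>S. (s, r) \<in> E)" for r
  have nonadj: "\<exists>z\<in>R. z \<noteq> y \<and> z \<noteq> r \<and> (r, z) \<in> E" if "r \<in> R" "\<not> adj r" for r y
    using other_neighbour[of r y] that irrefl E_in_V E_sym unfolding R_def adj_def by blast
  have some_adj: "\<exists>r\<in>R. adj r" if "R \<noteq> {}"
  proof -
    have "boundary E S \<noteq> {}" using cut SV card_S that by (intro cut) (auto simp: R_def)
    then show ?thesis using E_in_V by (auto simp: boundary_def adj_def R_def)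
  qed
  \<comment> \<open>Two neighbours on the same side would be the ends of an ear through
    \<open>z\<close>, against the maximality of \<open>S\<close>.\<close>
  have isolated: "\<exists>a\<in>S. \<exists>b\<in>S. (z, a) \<in> E \<and> (z, b) \<in> E \<and> f a \<noteq> f b"
    if z: "z \<in> R" "\<And>w. w \<in> R \<Longrightarrow> (z, w) \<notin> E" for z
  proof -
    obtain a where a: "(z, a) \<in> E" using other_neighbour[of z z] z by (auto simp: R_def)
    obtain b where b: "(z, b) \<in> E" "b \<noteq> a" using other_neighbour[of z a] z by (auto simp: R_def)
    have ab: "a \<in> S" "b \<in> S" using a b z(2) E_in_V by (auto simp: R_def)
    have "f a \<noteq> f b"
    proof
      assume "f a = f b"
      then have "card (insert z S) \<le> card S"
        using strong_on_ear[OF S ab(1,2) _ _ _ a b(1)] b(2) z(1) max by (auto simp: R_def)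
      then show False using z(1) SV by (simp add: R_def)
    qed
    then show ?thesis using a b ab by blast
  qed
  consider "card R = 0" | "card R = 1" | "card R = 2" | "card R = 3" | "card R = 4"
    using cardVR card_V card_S by linarith
  then show False
  proof cases
    case 1
    obtain s where "s \<in> S" using card_S by fastforce
    then show False using cover[of s s "[]" "[]"] 1 by simp
  next
    case 2
    then obtain r where r: "R = {r}" by (auto simp: card_1_singleton_iff)
    then obtain s where "s \<in> S" "(s, r) \<in> E" using some_adj by (auto simp: adj_def)
    then show False using cover[of s s "[r]" "[]"] r by simp
  next
    case 3
    then obtain a b where ab: "R = {a, b}" "a \<noteq> b" by (auto simp: card_2_iff)
    have "adj a" "adj b" using nonadj[of a b] nonadj[of b a] ab by auto
    then obtain s t where "s \<in> S" "(s, a) \<in> E" "t \<in> S" "(t, b) \<in> E" by (auto simp: adj_def)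
    then show False using cover[of s t "[a]" "[b]"] ab by simp
  next
    case 4
    \<comment> \<open>The ways to cover three vertices by paths from \<open>S\<close>: one path, or
      an edge and a single vertex. Excluding them makes \<open>R\<close> independent with every
      vertex adjacent to \<open>S\<close>.\<close>
    have T1: False if h: "a \<in> R" "b \<in> R" "c \<in> R" "distinct [a, b, c]" "adj a" "(a, b) \<in> E" "(b, c) \<in> E" for a b c
    proof -
      obtain s where "s \<in> S" "(s, a) \<in> E" using h(5) by (auto simp: adj_def)
      then show False using cover[of s s "[a, b, c]" "[]"] h 4 by simp
    qed
    have T2: False if h: "a \<in> R" "b \<in> R" "c \<in> R" "distinct [a, b, c]" "adj a" "(a, b) \<in> E" "adj c" for a b c
    proof -
      obtain s t where "s \<in> S" "(s, a) \<in> E" "t \<in> S" "(t, c) \<in> E" using h(5,7) by (auto simp: adj_def)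
      then show False using cover[of s t "[a, b]" "[c]"] h 4 by simp
    qed
    obtain a b c where abc: "R = {a, b, c}" "distinct [a, b, c]"
      using 4 by (auto simp: card_3_iff)
    have all_adj: "adj r" if r: "r \<in> R" for r
    proof (rule ccontr)
      assume na: "\<not> adj r"
      obtain r1 where r1: "r1 \<in> R" "adj r1" using some_adj abc by blast
      obtain r2 where r2: "r2 \<in> R" "r2 \<noteq> r1" "r2 \<noteq> r" "(r, r2) \<in> E" using nonadj[OF r na] by blast
      obtain r3 where r3: "r3 \<in> R" "r3 \<noteq> r2" "r3 \<noteq> r" "(r, r3) \<in> E" using nonadj[OF r na] by blast
      have "r1 \<noteq> r" using r1 na by auto
      then have "r3 = r1" using abc r r1 r2 r3 by auto
      then show False using T1[of r1 r r2] r r1 r2 r3 E_sym \<open>r1 \<noteq> r\<close> by auto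
    qed
    have indep: "(x, y) \<notin> E" if xy: "x \<in> R" "y \<in> R" for x y
    proof
      assume e: "(x, y) \<in> E"
      then have "x \<noteq> y" using irrefl by auto
      then obtain w where "w \<in> R" "w \<noteq> x" "w \<noteq> y" using abc by auto
      then show False using T2[of x y w] xy e \<open>x \<noteq> y\<close> all_adj by auto
    qed
    have card5: "card S \<le> 5" using cardVR card_V 4 by simp
    obtain p q Y where pq: "p \<noteq> q" "p \<notin> Y" "q \<notin> Y" "S = {p, q} \<union> Y" "card Y = card S - 2" "f p = f q"
      and Y: "\<And>r. r \<in> Y \<Longrightarrow> (p, r) \<in> E \<and> (q, r) \<in> E \<and> f r \<noteq> f p"
      using strong_on_card_4_5[OF S card_S card5] by metis
    have nbr: "\<exists>x y. x \<in> {p, q} \<and> y \<in> Y \<and> (z, x) \<in> E \<and> (z, y) \<in> E" if z: "z \<in> R" for z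
    proof -
      obtain u v where uv: "u \<in> S" "v \<in> S" "(z, u) \<in> E" "(z, v) \<in> E" "f u \<noteq> f v"
        using isolated[OF z] indep[OF z] by blast
      show ?thesis
      proof (cases "u \<in> Y")
        case True
        then have "v \<in> {p, q}" using uv pq Y[of u] Y[of v] by auto
        then show ?thesis using uv True by blast
      next
        case False
        then have "u \<in> {p, q}" "v \<in> Y" using uv pq by auto
        then show ?thesis using uv by blast
      qed
    qed
    then obtain X N where XN: "\<And>z. z \<in> R \<Longrightarrow> X z \<in> {p, q} \<and> N z \<in> Y \<and> (z, X z) \<in> E \<and> (z, N z) \<in> E"
      by metis
    have RS: "z \<notin> {p, q} \<union> Y" if "z \<in> R" for z using that pq(4) by (auto simp: R_def)
    \<comment> \<open>Different neighbours in \<open>Y\<close> would produce a strong set of six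
      vertices, while \<open>S\<close> has at most five.\<close>
    have same: "N z = N w" if zw: "z \<in> R" "w \<in> R" for z w
    proof (rule ccontr)
      assume ne: "N z \<noteq> N w"
      then have "z \<noteq> w" by auto
      have "\<exists>g F T. strong_on g F T \<and> card T = 6"
        by (rule strong_on_hexagon[OF pq(1-3) _ \<open>z \<noteq> w\<close> RS[OF zw(1)] RS[OF zw(2)], where ?x1.0 = "X z"
              and ?x2.0 = "X w" and ?y1.0 = "N z" and ?y2.0 = "N w"])
          (use Y XN[OF zw(1)] XN[OF zw(2)] ne in auto)
      then show False using max card5 by fastforce
    qed
    \<comment> \<open>The common neighbours \<open>x\<close> and \<open>r\<close> of
      \<open>z1\<close> and \<open>z2\<close> form a 4-cycle with them. From this cycle
      \<open>z3\<close> hangs at \<open>r\<close>, and the rest of \<open>S\<close> is a path from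
      \<open>x\<close> alternating between \<open>Y\<close> and \<open>x'\<close>.\<close>
    have fin: False if z: "z1 \<in> R" "z2 \<in> R" "z3 \<in> R" "distinct [z1, z2, z3]" and X: "X z1 = X z2" for z1 z2 z3
    proof -
      define x where "x = X z1"
      define r where "r = N z1"
      define x' where "x' = (if x = p then q else p)"
      have r: "N z1 = r" "N z2 = r" "N z3 = r" using same[OF z(2,1)] same[OF z(3,1)] by (auto simp: r_def)
      have x: "x \<in> {p, q}" "x' \<in> {p, q}" "x' \<noteq> x" "{p, q} = {x, x'}"
        using XN[OF z(1)] pq(1) by (auto simp: x_def x'_def)
      have e: "(z1, x) \<in> E" "(z1, r) \<in> E" "(z2, x) \<in> E" "(z2, r) \<in> E" "(z3, r) \<in> E" "r \<in> Y"
        using XN[OF z(1)] XN[OF z(2)] XN[OF z(3)] X r by (auto simp: x_def)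
      have xY: "(x, y) \<in> E" "(x', y) \<in> E" "(y, x) \<in> E" "(y, x') \<in> E" if "y \<in> Y" for y
        using Y[OF that] x(1,2) E_sym by auto
      have nR: "z1 \<notin> S" "z2 \<notin> S" "z3 \<notin> S" using z by (auto simp: R_def)
      have inS: "x \<in> S" "x' \<in> S" "r \<in> S" using x e pq by auto
      have nY: "x \<notin> Y" "x' \<notin> Y" using x pq by auto
      obtain F where F: "strong_on (\<lambda>u. u \<in> {x, r}) F {x, z1, r, z2}"
        using strong_on_cycle4[of x z1 r z2] e z nR inS nY E_sym by auto
      have Req: "R = {z1, z2, z3}"
        using z 4 finR by (intro card_seteq[symmetric]) auto
      have Veq: "V = S \<union> {z1, z2, z3}" using Req SV by (auto simp: R_def)
      have "card Y = 2 \<or> card Y = 3" using pq(5) card_S card5 by auto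
      then have "card (Y - {r}) = 1 \<or> card (Y - {r}) = 2" using e(6) by (auto simp: card_Diff_singleton)
      then show False
      proof
        assume "card (Y - {r}) = 1"
        then obtain r2 where r2: "Y - {r} = {r2}" by (auto simp: card_1_singleton_iff)
        have r2': "r2 \<in> Y" "r2 \<noteq> r" "S = {x, x', r, r2}" using r2 e(6) pq(4) x(4) by auto
        have "two_proper_connected V E"
          by (rule two_paths_from_strong[OF F, where s = r and t = x and p = "[z3]" and q = "[r2, x']"])
            (use e r2' nR inS nY z x(3) E_sym xY Veq in auto)
        then show False using NG by blast
      next
        assume "card (Y - {r}) = 2"
        then obtain r2 r3 where r2: "Y - {r} = {r2, r3}" "r2 \<noteq> r3" by (auto simp: card_2_iff)
        have r2': "r2 \<in> Y" "r2 \<noteq> r" "r3 \<in> Y" "r3 \<noteq> r" "S = {x, x', r, r2, r3}"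
          using r2 e(6) pq(4) x(4) by auto
        have "two_proper_connected V E"
          by (rule two_paths_from_strong[OF F, where s = r and t = x and p = "[z3]" and q = "[r2, x', r3]"])
            (use e r2' r2(2) nR inS nY z x(3) E_sym xY Veq in auto)
        then show False using NG by blast
      qed
    qed
    \<comment> \<open>Three vertices, but only two values in \<open>{p, q}\<close>.\<close>
    have "X a = X b \<or> X a = X c \<or> X b = X c"
      using XN[of a] XN[of b] XN[of c] abc by auto
    then show False using fin[of a b c] fin[of a c b] fin[of b c a] abc by auto
  next
    case 5
    have Q1: False if h: "a \<in> R" "b \<in> R" "c \<in> R" "d \<in> R" "distinct [a, b, c, d]"
      "adj a" "(a, b) \<in> E" "(b, c) \<in> E" "adj d" for a b c d
    proof -
      obtain s t where "s \<in> S" "(s, a) \<in> E" "t \<in> S" "(t, d) \<in> E" using h(6,9) by (auto simp: adj_def)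
      then show False using cover[of s t "[a, b, c]" "[d]"] h 5 by simp
    qed
    have Q2: False if h: "a \<in> R" "b \<in> R" "c \<in> R" "d \<in> R" "distinct [a, b, c, d]"
      "adj a" "(a, b) \<in> E" "adj c" "(c, d) \<in> E" for a b c d
    proof -
      obtain s t where "s \<in> S" "(s, a) \<in> E" "t \<in> S" "(t, c) \<in> E" using h(6,8) by (auto simp: adj_def)
      then show False using cover[of s t "[a, b]" "[c, d]"] h 5 by simp
    qed
    have Q3: False if h: "a \<in> R" "b \<in> R" "c \<in> R" "d \<in> R" "distinct [a, b, c, d]"
      "adj a" "(a, b) \<in> E" "(b, c) \<in> E" "(c, d) \<in> E" for a b c d
    proof -
      obtain s where "s \<in> S" "(s, a) \<in> E" using h(6) by (auto simp: adj_def)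
      then show False using cover[of s s "[a, b, c, d]" "[]"] h 5 by simp
    qed
    have R4: "R = {a, b, c, d}" if "a \<in> R" "b \<in> R" "c \<in> R" "d \<in> R" "distinct [a, b, c, d]" for a b c d
      using that 5 finR by (intro card_seteq[symmetric]) auto
    have pick: "\<exists>y\<in>R. y \<notin> T" if "card T < 4" "finite T" for T
      using that 5 card_mono[of T R] by fastforce
    have all_adj: "adj r" if r: "r \<in> R" for r
    proof (rule ccontr)
      assume na: "\<not> adj r"
      obtain r1 where r1: "r1 \<in> R" "r1 \<noteq> r" "(r, r1) \<in> E" using nonadj[OF r na] by blast
      obtain r2 where r2: "r2 \<in> R" "r2 \<noteq> r1" "r2 \<noteq> r" "(r, r2) \<in> E" using nonadj[OF r na] by blast
      obtain t where t: "t \<in> R" "t \<notin> {r, r1, r2}"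
        using pick[of "{r, r1, r2}"] r1 r2 by auto
      have R: "R = {r, r1, r2, t}" using R4[of r r1 r2 t] r r1 r2 t by auto
      have es: "(r1, r) \<in> E" "(r2, r) \<in> E" using r1 r2 E_sym by auto
      show False
      proof (cases "adj t")
        case True
        have nr: "\<not> adj r1" "\<not> adj r2"
          using Q1[of r1 r r2 t] Q1[of r2 r r1 t] r r1 r2 t es True by auto
        have nt: "(t, r1) \<notin> E" "(t, r2) \<notin> E"
          using Q3[of t r1 r r2] Q3[of t r2 r r1] r r1 r2 t es True by auto
        then have nt': "(r1, t) \<notin> E" "(r2, t) \<notin> E" using E_sym by auto
        have "(r1, r2) \<in> E" using nonadj[OF r1(1) nr(1), of r] R nt' by auto
        \<comment> \<open>None of the three has a neighbour in \<open>S\<close>, and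
          \<open>r1\<close> and \<open>r2\<close> are not adjacent to \<open>t\<close>, so
          connectedness forces the edge from \<open>r\<close> to \<open>t\<close>.\<close>
        moreover have "boundary E {r, r1, r2} \<noteq> {}"
          using r r1 r2 t by (intro cut) (auto simp: R_def)
        then obtain a b where ab: "(a, b) \<in> E" "a \<in> {r, r1, r2}" "b \<notin> {r, r1, r2}"
          by (auto simp: boundary_def)
        then have "b \<notin> S" using nr na E_sym by (auto simp: adj_def)
        then have "b \<in> R" using E_in_V[OF ab(1)] by (simp add: R_def)
        then have "b = t" using R ab(3) by auto
        then have "(r, t) \<in> E" using ab nt' by auto
        ultimately show False using Q3[of t r r1 r2] r r1 r2 t True E_sym by auto
      next
        case False
        have "adj r1 \<or> adj r2" using some_adj R na False by auto
        moreover have "False" if u: "u \<in> R" "v \<in> R" "distinct [r, u, v, t]" "adj u" "(r, u) \<in> E" "(r, v) \<in> E" for u v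
        proof -
          have Ru: "R = {r, u, v, t}" using R4[of r u v t] r u t by auto
          have "(v, t) \<notin> E" using Q3[of u r v t] r u t E_sym by auto
          then have ntv: "(t, v) \<notin> E" using E_sym by auto
          obtain w where w: "w \<in> R" "w \<noteq> u" "w \<noteq> t" "(t, w) \<in> E" using nonadj[OF t(1) False] by blast
          then have "(t, r) \<in> E" using Ru ntv by auto
          moreover obtain w' where "w' \<in> R" "w' \<noteq> r" "w' \<noteq> t" "(t, w') \<in> E" using nonadj[OF t(1) False] by blast
          then have "(t, u) \<in> E" using Ru ntv by auto
          ultimately show False using Q3[of u t r v] r u t E_sym by auto
        qed
        from this[of r1 r2] this[of r2 r1] have "\<not> adj r1" "\<not> adj r2" using r1 r2 t by auto
        ultimately show False by simp
      qed
    qed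
    have card4: "card S = 4" "card S \<le> 5" using cardVR card_V card_S 5 by auto
    obtain p q Y where pq: "p \<noteq> q" "p \<notin> Y" "q \<notin> Y" "S = {p, q} \<union> Y" "card Y = card S - 2" "f p = f q"
      and Y: "\<And>r. r \<in> Y \<Longrightarrow> (p, r) \<in> E \<and> (q, r) \<in> E \<and> f r \<noteq> f p"
      using strong_on_card_4_5[OF S card_S card4(2)] by metis
    obtain r s where rs: "Y = {r, s}" "r \<noteq> s" using pq(5) card4 by (auto simp: card_2_iff)
    define iso where "iso z \<longleftrightarrow> z \<in> R \<and> (\<forall>w\<in>R. (z, w) \<notin> E)" for z
    have "\<exists>x y. x \<in> {p, q} \<and> y \<in> Y \<and> (z, x) \<in> E \<and> (z, y) \<in> E" if z: "iso z" for z
    proof -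
      obtain u v where uv: "u \<in> S" "v \<in> S" "(z, u) \<in> E" "(z, v) \<in> E" "f u \<noteq> f v"
        using isolated[of z] z unfolding iso_def by blast
      show ?thesis
      proof (cases "u \<in> Y")
        case True
        then have "v \<in> {p, q}" using uv pq Y[of u] Y[of v] by auto
        then show ?thesis using uv True by blast
      next
        case False
        then have "u \<in> {p, q}" "v \<in> Y" using uv pq by auto
        then show ?thesis using uv by blast
      qed
    qed
    then obtain X N where XN: "\<And>z. iso z \<Longrightarrow> X z \<in> {p, q} \<and> N z \<in> Y \<and> (z, X z) \<in> E \<and> (z, N z) \<in> E"
      by metis
    have RS: "z \<notin> {p, q} \<union> Y" "z \<notin> Y \<union> {p, q}" if "iso z" for z
      using that pq(4) by (auto simp: R_def iso_def)
    have no6: "\<not> (\<exists>g F T. strong_on g F T \<and> card T = 6)" using max card4 by fastforce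
    have same: "N z = N w" "X z = X w" if zw: "iso z" "iso w" for z w
    proof -
      show "N z = N w"
      proof (rule ccontr)
        assume ne: "N z \<noteq> N w"
        then have "z \<noteq> w" by auto
        have "\<exists>g F T. strong_on g F T \<and> card T = 6"
          by (rule strong_on_hexagon[OF pq(1-3) _ \<open>z \<noteq> w\<close> RS(1)[OF zw(1)] RS(1)[OF zw(2)], where ?x1.0 = "X z"
                and ?x2.0 = "X w" and ?y1.0 = "N z" and ?y2.0 = "N w"])
            (use Y XN[OF zw(1)] XN[OF zw(2)] ne in auto)
        then show False using no6 by blast
      qed
      \<comment> \<open>As \<open>card S = 4\<close>, both sides of \<open>S\<close> have two
        vertices, and the hexagon lemma applies with \<open>{p, q}\<close> and \<open>Y\<close>
        exchanged.\<close>
      show "X z = X w"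
      proof (rule ccontr)
        assume ne: "X z \<noteq> X w"
        then have "z \<noteq> w" by auto
        have "\<exists>g F T. strong_on g F T \<and> card T = 6"
        proof (rule strong_on_hexagon[OF rs(2), where Y = "{p, q}" and ?z1.0 = z and ?z2.0 = w
                and ?x1.0 = "N z" and ?x2.0 = "N w" and ?y1.0 = "X z" and ?y2.0 = "X w"])
          show "r \<notin> {p, q}" "s \<notin> {p, q}" using rs pq(2,3) by auto
          show "(r, u) \<in> E \<and> (s, u) \<in> E" if "u \<in> {p, q}" for u
            using that Y[of r] Y[of s] rs(1) E_sym by blast
        qed (use XN[OF zw(1)] XN[OF zw(2)] ne rs(1) \<open>z \<noteq> w\<close> RS(2)[OF zw(1)] RS(2)[OF zw(2)] in simp_all)
        then show False using no6 by blast
      qed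
    qed
    \<comment> \<open>The 4-cycle through \<open>z1\<close>, \<open>z2\<close> and their common
      neighbours \<open>x\<close>, \<open>y\<close> replaces \<open>S\<close>. The other vertices
      \<open>x'\<close> and \<open>y'\<close> of \<open>S\<close> are adjacent to each other and to
      \<open>y\<close> and \<open>x\<close> respectively, so they form the second path or lead to
      \<open>w1\<close> and \<open>w2\<close>.\<close>
    have two: False if z: "iso z1" "iso z2" "w1 \<in> R" "w2 \<in> R" "distinct [z1, z2, w1, w2]" for z1 z2 w1 w2
    proof -
      define x where "x = X z1"
      define y where "y = N z1"
      define x' where "x' = (if x = p then q else p)"
      define y' where "y' = (if y = r then s else r)"
      have x: "x \<in> {p, q}" "x' \<in> {p, q}" "x' \<noteq> x" "{p, q} = {x, x'}"
        using XN[OF z(1)] pq(1) by (auto simp: x_def x'_def)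
      have y: "y \<in> Y" "y' \<in> Y" "y' \<noteq> y" "Y = {y, y'}"
        using XN[OF z(1)] rs by (auto simp: y_def y'_def)
      have Seq: "S = {x, x', y, y'}" using pq(4) x(4) y(4) by auto
      have dS: "distinct [x, x', y, y']" using x y pq(1-3) by auto
      have e: "(z1, x) \<in> E" "(z1, y) \<in> E" "(z2, x) \<in> E" "(z2, y) \<in> E"
        using XN[OF z(1)] XN[OF z(2)] same[OF z(1,2)] by (auto simp: x_def y_def)
      have xY: "(x, y) \<in> E" "(x', y) \<in> E" "(x, y') \<in> E" "(x', y') \<in> E"
        using Y[of y] Y[of y'] x(1,2) y(1,2) by auto
      have nR: "z1 \<notin> S" "z2 \<notin> S" "w1 \<notin> S" "w2 \<notin> S" using z by (auto simp: R_def iso_def)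
      obtain F where F: "strong_on (\<lambda>u. u \<in> {x, y}) F {x, z1, y, z2}"
        using strong_on_cycle4[of x z1 y z2] e z nR dS Seq E_sym by auto
      have Req: "R = {z1, z2, w1, w2}" using R4[of z1 z2 w1 w2] z by (auto simp: iso_def)
      have Veq: "V = S \<union> {z1, z2, w1, w2}" using Req SV by (auto simp: R_def)
      show False
      proof (cases "(w1, w2) \<in> E")
        case True
        obtain c where c: "c \<in> S" "(c, w1) \<in> E" using all_adj[OF z(3)] by (auto simp: adj_def)
        note facts = e dS Seq nR z(5) True E_sym xY Veq c
        consider "c = x" | "c = y" | "c = y'" | "c = x'" using c Seq by auto
        then have "two_proper_connected V E"
        proof cases
          case 1
          show ?thesis
            by (rule two_paths_from_strong[OF F, where s = x and t = x and p = "[w1, w2]" and q = "[y', x']"])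
              (use facts 1 in auto)
        next
          case 2
          show ?thesis
            by (rule two_paths_from_strong[OF F, where s = y and t = x and p = "[w1, w2]" and q = "[y', x']"])
              (use facts 2 in auto)
        next
          case 3
          show ?thesis
            by (rule two_paths_from_strong[OF F, where s = y and t = x and p = "[x', y', w1, w2]" and q = "[]"])
              (use facts 3 in auto)
        next
          case 4
          show ?thesis
            by (rule two_paths_from_strong[OF F, where s = x and t = x and p = "[y', x', w1, w2]" and q = "[]"])
              (use facts 4 in auto)
        qed
        then show False using NG by blast
      next
        case False
        \<comment> \<open>Now \<open>w1\<close> is a third vertex adjacent to both \<open>x\<close>
          and \<open>y\<close>; the ear through it gives a strong set of five vertices, more than
          \<open>card S\<close>.\<close>
        have "iso w1"
          using False z Req irrefl E_sym unfolding iso_def by blast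
        then have "(w1, x) \<in> E" "(w1, y) \<in> E"
          using XN[of w1] same[OF z(1), of w1] by (auto simp: x_def y_def)
        then have "strong_on ((\<lambda>u. u \<in> {x, y})(w1 := \<not> (x \<in> {x, y}))) (insert (x, w1) (insert (w1, y) F))
            (insert w1 {x, z1, y, z2})"
          using z(5) nR Seq dS by (intro strong_on_ear[OF F]) auto
        then have "card (insert w1 {x, z1, y, z2}) \<le> 4" using max card4 by metis
        moreover have "distinct [w1, x, z1, y, z2]" using z(5) nR Seq dS by auto
        then have "card (insert w1 {x, z1, y, z2}) = 5" using distinct_card[of "[w1, x, z1, y, z2]"] by simp
        ultimately show False by simp
      qed
    qed
    show False
    \<comment> \<open>An edge inside \<open>R\<close> makes the other two vertices isolated in
      \<open>R\<close>, by \<open>Q1\<close> and \<open>Q2\<close>; without such an edge all four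
      are isolated.\<close>
    proof (cases "\<exists>w1\<in>R. \<exists>w2\<in>R. (w1, w2) \<in> E")
      case True
      then obtain w1 w2 where w: "w1 \<in> R" "w2 \<in> R" "(w1, w2) \<in> E" by blast
      then have "w1 \<noteq> w2" using irrefl by auto
      obtain z1 where z1: "z1 \<in> R" "z1 \<notin> {w1, w2}" using pick[of "{w1, w2}"] \<open>w1 \<noteq> w2\<close> by auto
      obtain z2 where z2: "z2 \<in> R" "z2 \<notin> {w1, w2, z1}" using pick[of "{w1, w2, z1}"] \<open>w1 \<noteq> w2\<close> z1 by auto
      have Req: "R = {w1, w2, z1, z2}" using R4[of w1 w2 z1 z2] w z1 z2 \<open>w1 \<noteq> w2\<close> by auto
      have "iso u" if u: "u \<in> R" "v \<in> R" "distinct [w1, w2, u, v]" for u v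
      proof -
        have "(u, w1) \<notin> E" using Q1[of u w1 w2 v] all_adj u w by auto
        moreover have "(u, w2) \<notin> E" using Q1[of u w2 w1 v] all_adj u w E_sym by auto
        moreover have "(u, v) \<notin> E" using Q2[of w1 w2 u v] all_adj u w by auto
        moreover have "R = {w1, w2, u, v}" using R4[of w1 w2 u v] w u by auto
        ultimately show ?thesis using irrefl u by (auto simp: iso_def)
      qed
      then have "iso z1" "iso z2" using z1 z2 \<open>w1 \<noteq> w2\<close> by auto
      then show False using two[of z1 z2 w1 w2] w z1 z2 \<open>w1 \<noteq> w2\<close> by auto
    next
      case False
      then have all_iso: "iso z" if "z \<in> R" for z using that by (auto simp: iso_def)
      obtain a where a: "a \<in> R" using 5 by fastforce
      obtain b where b: "b \<in> R" "b \<notin> {a}" using pick[of "{a}"] by auto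
      obtain c where c: "c \<in> R" "c \<notin> {a, b}" using pick[of "{a, b}"] b by auto
      obtain d where d: "d \<in> R" "d \<notin> {a, b, c}" using pick[of "{a, b, c}"] b c by auto
      show False using two[of a b c d] all_iso a b c d by auto
    qed
  qed
qed

end

section \<open>Graphs without even cycles\<close>

definition isomorphic_to :: "'a set \<Rightarrow> 'a rel \<Rightarrow> nat pair_pre_digraph \<Rightarrow> bool" where
  "isomorphic_to V E H \<longleftrightarrow> (\<exists>g. inj_on g V \<and> g ` V = pverts H \<and> map_prod g g ` E = parcs H)"

lemma isomorphic_to_G1:
  assumes d: "distinct [c, u1, u2, u3, u4, u5, u6]" and V: "V = {c, u1, u2, u3, u4, u5, u6}"
    and E: "E = {(c, u1), (u1, c), (c, u2), (u2, c), (c, u3), (u3, c), (c, u4), (u4, c), (c, u5), (u5, c),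
      (c, u6), (u6, c), (u1, u2), (u2, u1), (u3, u4), (u4, u3), (u5, u6), (u6, u5)}"
  shows "isomorphic_to V E G1"
proof -
  define g :: "'a \<Rightarrow> nat" where "g x = (if x = c then 0 else if x = u1 then 1 else if x = u2 then 2
    else if x = u3 then 3 else if x = u4 then 4 else if x = u5 then 5 else 6)" for x
  have g: "g c = 0" "g u1 = 1" "g u2 = 2" "g u3 = 3" "g u4 = 4" "g u5 = 5" "g u6 = 6"
    using d by (auto simp: g_def)
  have "inj_on g V" unfolding V inj_on_def by (simp add: g)
  moreover have "g ` V = pverts G1" unfolding V G1_def mk_symmetric_def by (simp add: g)
  moreover have "map_prod g g ` E = parcs G1"
    unfolding E G1_def mk_symmetric_def by (rule equalityI) (simp_all add: g)
  ultimately show ?thesis unfolding isomorphic_to_def by blast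
qed

lemma isomorphic_to_G2:
  assumes d: "distinct [v, u1, u2, w1, w2, w3, w4, w5]" and V: "V = {v, u1, u2, w1, w2, w3, w4, w5}"
    and E: "E = {(v, u1), (u1, v), (v, u2), (u2, v), (u1, u2), (u2, u1), (v, w1), (w1, v),
      (w1, w2), (w2, w1), (w1, w5), (w5, w1), (w2, w5), (w5, w2), (w1, w3), (w3, w1), (w1, w4), (w4, w1),
      (w3, w4), (w4, w3)}"
  shows "isomorphic_to V E G2"
proof -
  define g :: "'a \<Rightarrow> nat" where "g x = (if x = v then 0 else if x = u1 then 1 else if x = u2 then 2
    else if x = w1 then 3 else if x = w2 then 4 else if x = w3 then 5 else if x = w4 then 6 else 7)" for x
  have g: "g v = 0" "g u1 = 1" "g u2 = 2" "g w1 = 3" "g w2 = 4" "g w3 = 5" "g w4 = 6" "g w5 = 7"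
    using d by (auto simp: g_def)
  have "inj_on g V" unfolding V inj_on_def by (simp add: g)
  moreover have "g ` V = pverts G2" unfolding V G2_def mk_symmetric_def by (simp add: g)
  moreover have "map_prod g g ` E = parcs G2"
    unfolding E G2_def mk_symmetric_def by (rule equalityI) (simp_all add: g)
  ultimately show ?thesis unfolding isomorphic_to_def by blast
qed

text \<open>An even cycle is a strong set, so \<open>no_strong\<close> leaves only odd cycles, and
  the blocks of the graph are single edges and odd cycles. Only the absence of 4-cycles and 6-cycles
  is used below.\<close>

locale cactus_graph = small_graph +
  assumes no_strong: "strong_on g F T \<Longrightarrow> card T < 4"
begin

lemma no_C4:
  assumes "distinct [a, b, c, d]" "(a, b) \<in> E" "(b, c) \<in> E" "(c, d) \<in> E" "(d, a) \<in> E"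
  shows False
proof -
  have "card {a, b, c, d} < 4" using strong_on_cycle4[OF assms] no_strong by blast
  then show False using distinct_card[OF assms(1)] by simp
qed

lemma no_C6:
  assumes "distinct [a, b, c, d, e, f]" "(a, b) \<in> E" "(b, c) \<in> E" "(c, d) \<in> E" "(d, e) \<in> E"
    "(e, f) \<in> E" "(f, a) \<in> E"
  shows False
proof -
  have "card {a, b, c, d, e, f} < 4" using strong_on_cycle6[OF assms] no_strong by blast
  then show False using distinct_card[OF assms(1)] by simp
qed

section \<open>Longest paths\<close>

definition path :: "'a list \<Rightarrow> bool" where
  "path p \<longleftrightarrow> distinct p \<and> successively (\<lambda>x y. (x, y) \<in> E) p \<and> set p \<subseteq> V"

definition longest :: "'a list \<Rightarrow> bool" where
  "longest p \<longleftrightarrow> path p \<and> (\<forall>q. path q \<longrightarrow> length q \<le> length p)"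

lemma path_rev: "path p \<Longrightarrow> path (rev p)"
  unfolding path_def using E_sym by (auto elim!: successively_mono)

lemma longest_rev: "longest p \<Longrightarrow> longest (rev p)"
  unfolding longest_def using path_rev by auto

lemma longest_end:
  assumes "longest (a # p)" "(a, y) \<in> E"
  shows "y \<in> set p"
proof (rule ccontr)
  assume "y \<notin> set p"
  then have "path (y # a # p)"
    using assms E_sym E_in_V irrefl by (auto simp: longest_def path_def)
  then show False using assms(1) by (auto simp: longest_def)
qed

text \<open>Adjacent ends would close the path to a cycle, which can be cut open at a vertex with a
  neighbour outside; that neighbour prolongs the path.\<close>

lemma longest_not_closed:
  assumes "longest p" "p \<noteq> []" "set p \<noteq> V"
  shows "(last p, hd p) \<notin> E"
proof
  assume closed: "(last p, hd p) \<in> E"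
  have p: "path p" using assms by (simp add: longest_def)
  then obtain x y where xy: "(x, y) \<in> E" "x \<in> set p" "y \<notin> set p"
    using cut[of "set p"] assms by (auto simp: boundary_def path_def)
  then obtain q r where qr: "p = q @ x # r" by (meson split_list)
  have "successively (\<lambda>x y. (x, y) \<in> E) (x # r)" "successively (\<lambda>x y. (x, y) \<in> E) q"
    using p unfolding path_def qr by (simp_all only: successively_append_iff)
  moreover have "(last (x # r), hd q) \<in> E" if "q \<noteq> []" using closed that unfolding qr by simp
  ultimately have "successively (\<lambda>x y. (x, y) \<in> E) ((x # r) @ q)"
    unfolding successively_append_iff by blast
  then have "path (y # x # r @ q)"
    using p xy(3) E_sym[OF xy(1)] E_in_V[OF xy(1)] unfolding path_def qr by auto
  then show False using assms(1) by (auto simp: longest_def qr)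
qed

text \<open>The second neighbours of both ends can only be \<open>c\<close>, which gives two
  triangles at \<open>c\<close>. All else is attached at \<open>c\<close>, again in triangles, since
  otherwise a path of six vertices appears. A fourth triangle would need nine vertices.\<close>

lemma longest_5:
  assumes L: "longest [a, b, c, d, e]" and V: "set [a, b, c, d, e] \<noteq> V"
  shows "isomorphic_to V E G1"
proof -
  define P where "P = {a, b, c, d, e}"
  have p: "distinct [a, b, c, d, e]" "(a, b) \<in> E" "(b, c) \<in> E" "(c, d) \<in> E" "(d, e) \<in> E" "P \<subseteq> V"
    using L by (auto simp: longest_def path_def P_def)
  have ps: "(b, a) \<in> E" "(c, b) \<in> E" "(d, c) \<in> E" "(e, d) \<in> E" using p E_sym by auto
  have R: "longest [e, d, c, b, a]" using longest_rev[OF L] by simp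
  have long: False if "path q" "length q > 5" for q using L that by (fastforce simp: longest_def)
  have ea: "(e, a) \<notin> E" "(a, e) \<notin> E" using longest_not_closed[OF L _ V] E_sym by auto
  have ad: "(a, d) \<notin> E" "(d, a) \<notin> E" using no_C4[of a b c d] p E_sym by auto
  have be: "(b, e) \<notin> E" "(e, b) \<notin> E" using no_C4[of e b c d] p ps E_sym by auto
  have ac: "(a, c) \<in> E" "(c, a) \<in> E"
  proof -
    obtain y where "(a, y) \<in> E" "y \<noteq> b" using other_neighbour[of a b] p by (auto simp: P_def)
    then show "(a, c) \<in> E" using longest_end[OF L, of y] ea ad by auto
    then show "(c, a) \<in> E" by (rule E_sym)
  qed
  have ec: "(e, c) \<in> E" "(c, e) \<in> E"
  proof -
    obtain y where "(e, y) \<in> E" "y \<noteq> d" using other_neighbour[of e d] p by (auto simp: P_def)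
    then show "(e, c) \<in> E" using longest_end[OF R, of y] ea be by auto
    then show "(c, e) \<in> E" by (rule E_sym)
  qed
  have bd: "(b, d) \<notin> E" "(d, b) \<notin> E" using no_C4[of b d c a] p ps ac E_sym by auto
  have out: "x = c" if xy: "(x, y) \<in> E" "x \<in> P" "y \<notin> P" for x y
  proof -
    have y: "y \<in> V" "(y, x) \<in> E" using xy E_in_V E_sym by auto
    have "x \<noteq> a" using longest_end[OF L, of y] xy by (auto simp: P_def)
    moreover have "x \<noteq> e" using longest_end[OF R, of y] xy by (auto simp: P_def)
    moreover have "x \<noteq> b" using long[of "[y, b, a, c, d, e]"] p ps ac y xy by (auto simp: path_def P_def)
    moreover have "x \<noteq> d" using long[of "[y, d, e, c, b, a]"] p ps ec y xy by (auto simp: path_def P_def)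
    ultimately show ?thesis using xy(2) by (auto simp: P_def)
  qed
  have outer: "\<exists>w. w \<notin> P \<and> w \<noteq> z \<and> (z, w) \<in> E \<and> (c, w) \<in> E \<and> (\<forall>y. (z, y) \<in> E \<longrightarrow> y \<in> {c, w})"
    if z: "z \<notin> P" "(c, z) \<in> E" for z
  proof -
    have zV: "z \<in> V" using z E_in_V by auto
    obtain w where w: "(z, w) \<in> E" "w \<noteq> c" using other_neighbour[OF zV] by blast
    have wP: "w \<notin> P" using out[of w z] w z E_sym by auto
    have wV: "w \<in> V" and wz: "w \<noteq> z" using w E_in_V irrefl by auto
    obtain y where y: "(w, y) \<in> E" "y \<noteq> z" using other_neighbour[OF wV] by blast
    have "y \<in> P"
    proof (rule ccontr)
      assume "y \<notin> P"
      then show False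
        using long[of "[a, b, c, z, w, y]"] p z w y wP wz E_in_V irrefl by (auto simp: path_def P_def)
    qed
    then have "y = c" using out[of y w] y wP E_sym by auto
    then have cw: "(c, w) \<in> E" using y E_sym by auto
    have "y' \<in> {c, w}" if y': "(z, y') \<in> E" for y'
    proof (cases "y' \<in> P")
      case True
      then show ?thesis using out[of y' z] y' z E_sym by auto
    next
      case False
      have "(w, z) \<in> E" "y' \<in> V" "y' \<noteq> z" using w y' E_sym E_in_V irrefl by auto
      then show ?thesis
        using long[of "[a, b, c, w, z, y']"] p z cw wz y' wP wV zV False by (auto simp: path_def P_def)
    qed
    then show ?thesis using wP wz w cw by blast
  qed
  have "boundary E P \<noteq> {}" using p(6) V by (intro cut) (auto simp: P_def)
  then obtain z where z: "z \<notin> P" "(c, z) \<in> E" using out by (auto simp: boundary_def)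
  then obtain w where w: "w \<notin> P" "w \<noteq> z" "(z, w) \<in> E" "(c, w) \<in> E" and Nz: "\<And>y. (z, y) \<in> E \<Longrightarrow> y \<in> {c, w}"
    using outer[OF z] by blast
  have zc: "z \<noteq> c" "w \<noteq> c" using z w by (auto simp: P_def)
  have Nw: "y \<in> {c, z}" if "(w, y) \<in> E" for y
    using outer[OF w(1,4)] that E_sym[OF w(3)] zc by blast
  have zwV: "z \<in> V" "w \<in> V" using w E_in_V by auto
  define X where "X = P \<union> {z, w}"
  have "X = V"
  proof (rule ccontr)
    assume "X \<noteq> V"
    then have "boundary E X \<noteq> {}" using p(6) zwV by (intro cut) (auto simp: X_def P_def)
    then obtain x y where xy: "(x, y) \<in> E" "x \<in> X" "y \<notin> X" by (auto simp: boundary_def)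
    have "x \<noteq> z" "x \<noteq> w" using xy Nz Nw by (auto simp: X_def P_def)
    then have "x = c" using out[of x y] xy by (auto simp: X_def)
    then have cy: "(c, y) \<in> E" "y \<notin> P" using xy by (auto simp: X_def)
    then obtain y' where y': "y' \<notin> P" "y' \<noteq> y" "(y, y') \<in> E" using outer[of y] by blast
    have "y' \<noteq> z" "y' \<noteq> w" using Nz[of y] Nw[of y] xy E_sym[OF y'(3)] by (auto simp: X_def P_def)
    then have "distinct [a, b, c, d, e, z, w, y, y']"
      using p(1) z w y' cy xy by (auto simp: X_def P_def)
    then have "card {a, b, c, d, e, z, w, y, y'} = 9" using distinct_card by fastforce
    moreover have "{a, b, c, d, e, z, w, y, y'} \<subseteq> V" using p(6) zwV y' E_in_V by (auto simp: P_def)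
    ultimately have "9 \<le> card V" using card_mono[OF finite_V] by metis
    then show False using card_V by simp
  qed
  then have V': "V = {c, a, b, d, e, z, w}" by (auto simp: X_def P_def)
  have Na: "y \<in> {b, c}" if "(a, y) \<in> E" for y using longest_end[OF L that] that ea ad by auto
  have Ne: "y \<in> {d, c}" if "(e, y) \<in> E" for y using longest_end[OF R that] that ea be by auto
  have bP: "y \<in> P" if "(b, y) \<in> E" for y using out[OF that] p(1) by (auto simp: P_def)
  have dP: "y \<in> P" if "(d, y) \<in> E" for y using out[OF that] p(1) by (auto simp: P_def)
  have Nb: "y \<in> {a, c}" if "(b, y) \<in> E" for y using bP[OF that] that be bd irrefl by (auto simp: P_def)
  have Nd: "y \<in> {e, c}" if "(d, y) \<in> E" for y using dP[OF that] that ad bd irrefl by (auto simp: P_def)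
  have "E = {(c, a), (a, c), (c, b), (b, c), (c, d), (d, c), (c, e), (e, c), (c, z), (z, c),
      (c, w), (w, c), (a, b), (b, a), (d, e), (e, d), (z, w), (w, z)}" (is "_ = ?F")
  proof
    show "?F \<subseteq> E" using p ps ac ec z w E_sym by auto
    show "E \<subseteq> ?F"
    proof (rule subrelI)
      fix x y assume xy: "(x, y) \<in> E"
      then have "x \<in> V" "y \<in> V" "x \<noteq> y" using E_in_V irrefl by auto
      then consider "x = c" "y \<in> {a, b, d, e, z, w}" | "x = a" | "x = b" | "x = d" | "x = e" | "x = z" | "x = w"
        using V' by blast
      then show "(x, y) \<in> ?F"
        using Na[of y] Nb[of y] Nd[of y] Ne[of y] Nz[of y] Nw[of y] xy by cases auto
    qed
  qed
  moreover have "distinct [c, a, b, d, e, z, w]" using p(1) z w by (auto simp: P_def)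
  ultimately show ?thesis using isomorphic_to_G1[of c a b d e z w] V' by blast
qed

text \<open>The excluded chords leave the triangles \<open>a b c\<close> and \<open>c z w\<close> at
  \<open>c\<close> and the triangle \<open>d e f\<close> joined by the edge from \<open>c\<close> to
  \<open>d\<close>, so \<open>c\<close> is the \<open>w1\<close> and \<open>d\<close> the
  \<open>v\<close> of \<open>G2\<close>.\<close>

lemma longest_6_triangle:
  assumes L: "longest [a, b, c, d, e, f]"
    and V: "V = {a, b, c, d, e, f, z, w}" and dist: "distinct [a, b, c, d, e, f, z, w]"
    and zw: "(z, w) \<in> E" "(z, c) \<in> E" "(w, c) \<in> E"
    and uniq: "\<And>x. (z, x) \<in> E \<or> (w, x) \<in> E \<Longrightarrow> x \<in> {c, z, w}"
    and a: "(a, c) \<in> E \<or> (a, e) \<in> E" and f: "(f, d) \<in> E \<or> (f, b) \<in> E"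
  shows "isomorphic_to V E G2"
proof -
  have p: "(a, b) \<in> E" "(b, c) \<in> E" "(c, d) \<in> E" "(d, e) \<in> E" "(e, f) \<in> E"
    using L by (auto simp: longest_def path_def)
  have ps: "(b, a) \<in> E" "(c, b) \<in> E" "(d, c) \<in> E" "(e, d) \<in> E" "(f, e) \<in> E" using p E_sym by auto
  have long: False if "path q" "length q > 6" for q using L that by (fastforce simp: longest_def)
  have R: "longest [f, e, d, c, b, a]" using longest_rev[OF L] by simp
  have ne: "set [a, b, c, d, e, f] \<noteq> V" using V dist by auto
  have fa: "(f, a) \<notin> E" "(a, f) \<notin> E" using longest_not_closed[OF L _ ne] E_sym by auto
  have ad: "(a, d) \<notin> E" "(d, a) \<notin> E" using no_C4[of a b c d] p dist E_sym by auto
  \<comment> \<open>The chord from \<open>a\<close> to \<open>e\<close> would allow the path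
    \<open>w, z, c, b, a, e, f\<close> of seven vertices.\<close>
  have ae: "(a, e) \<notin> E" "(e, a) \<notin> E"
  proof -
    have "{a, b, c, d, e, f, z, w} \<subseteq> V" using V by simp
    then show "(a, e) \<notin> E"
      using long[of "[w, z, c, b, a, e, f]"] p ps zw E_sym[OF zw(1)] dist by (auto simp: path_def)
    then show "(e, a) \<notin> E" using E_sym by blast
  qed
  have ac: "(a, c) \<in> E" "(c, a) \<in> E" using a ae E_sym by auto
  have fb: "(f, b) \<notin> E" "(b, f) \<notin> E" using no_C6[of a b f e d c] p ps ac dist E_sym by auto
  have fd: "(f, d) \<in> E" "(d, f) \<in> E" using f fb E_sym by auto
  have bd: "(b, d) \<notin> E" "(d, b) \<notin> E" using no_C4[of b d c a] p ps ac dist E_sym by auto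
  have be: "(b, e) \<notin> E" "(e, b) \<notin> E" using no_C6[of b e f d c a] p ps ac fd dist E_sym by auto
  have ce: "(c, e) \<notin> E" "(e, c) \<notin> E" using no_C4[of c e f d] p ps fd dist E_sym by auto
  have cf: "(c, f) \<notin> E" "(f, c) \<notin> E" using no_C4[of c f e d] p ps fd dist E_sym by auto
  have nz: "(x, z) \<notin> E" "(x, w) \<notin> E" if "x \<in> {a, b, d, e, f}" for x
    using that uniq[of x] dist E_sym by auto
  have inV: "y \<in> {a, b, c, d, e, f, z, w}" "y \<noteq> x" if "(x, y) \<in> E" for x y
    using that E_in_V irrefl V by auto
  have Na: "y \<in> {b, c}" if "(a, y) \<in> E" for y using inV[OF that] that fa ad ae nz[of a] by auto
  have Nb: "y \<in> {a, c}" if "(b, y) \<in> E" for y using inV[OF that] that bd be fb nz[of b] by auto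
  have Nc: "y \<in> {a, b, d, z, w}" if "(c, y) \<in> E" for y using inV[OF that] that ce cf by auto
  have Nd: "y \<in> {c, e, f}" if "(d, y) \<in> E" for y using inV[OF that] that ad bd nz[of d] by auto
  have Ne: "y \<in> {d, f}" if "(e, y) \<in> E" for y using inV[OF that] that ae be ce nz[of e] by auto
  have Nf: "y \<in> {d, e}" if "(f, y) \<in> E" for y using inV[OF that] that fa fb cf nz[of f] by auto
  have Nz: "y \<in> {c, w}" if "(z, y) \<in> E" for y using uniq[of y] that irrefl by auto
  have Nw: "y \<in> {c, z}" if "(w, y) \<in> E" for y using uniq[of y] that irrefl by auto
  have "E = {(d, e), (e, d), (d, f), (f, d), (e, f), (f, e), (d, c), (c, d),
      (c, a), (a, c), (c, b), (b, c), (a, b), (b, a), (c, z), (z, c), (c, w), (w, c), (z, w), (w, z)}"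
    (is "_ = ?F")
  proof
    show "?F \<subseteq> E" using p ps ac fd zw E_sym by auto
    show "E \<subseteq> ?F"
    proof (rule subrelI)
      fix x y assume xy: "(x, y) \<in> E"
      then consider "x = a" | "x = b" | "x = c" | "x = d" | "x = e" | "x = f" | "x = z" | "x = w"
        using E_in_V V by blast
      then show "(x, y) \<in> ?F"
        using Na[of y] Nb[of y] Nc[of y] Nd[of y] Ne[of y] Nf[of y] Nz[of y] Nw[of y] xy by cases auto
    qed
  qed
  moreover have "distinct [d, e, f, c, a, z, w, b]" using dist by auto
  moreover have "V = {d, e, f, c, a, z, w, b}" using V by auto
  ultimately show ?thesis by (intro isomorphic_to_G2[of d e f c a z w b])
qed

text \<open>A vertex outside the path has at most one neighbour on it, hence another neighbour
  outside, and eight vertices leave room for exactly two, \<open>z\<close> and \<open>w\<close>.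
  Both are attached to the same one of \<open>c\<close> and \<open>d\<close>, as otherwise a 4-cycle
  arises; reversing the path exchanges the two cases.\<close>

lemma longest_6:
  assumes L: "longest [a, b, c, d, e, f]" and V: "set [a, b, c, d, e, f] \<noteq> V"
  shows "isomorphic_to V E G2"
proof -
  define P where "P = {a, b, c, d, e, f}"
  have p: "distinct [a, b, c, d, e, f]" "(a, b) \<in> E" "(b, c) \<in> E" "(c, d) \<in> E" "(d, e) \<in> E" "(e, f) \<in> E"
      "P \<subseteq> V"
    using L by (auto simp: longest_def path_def P_def)
  have ps: "(b, a) \<in> E" "(c, b) \<in> E" "(d, c) \<in> E" "(e, d) \<in> E" "(f, e) \<in> E" using p E_sym by auto
  have R: "longest [f, e, d, c, b, a]" using longest_rev[OF L] by simp
  have long: False if "path q" "length q > 6" for q using L that by (fastforce simp: longest_def)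
  have fa: "(f, a) \<notin> E" "(a, f) \<notin> E" using longest_not_closed[OF L _ V] E_sym by auto
  have ad: "(a, d) \<notin> E" using no_C4[of a b c d] p E_sym by auto
  have cf: "(f, c) \<notin> E" using no_C4[of f c d e] p ps E_sym by auto
  have Na: "(a, c) \<in> E \<or> (a, e) \<in> E"
  proof -
    obtain y where "(a, y) \<in> E" "y \<noteq> b" using other_neighbour[of a b] p by (auto simp: P_def)
    then show ?thesis using longest_end[OF L, of y] fa ad by auto
  qed
  have Nf: "(f, d) \<in> E \<or> (f, b) \<in> E"
  proof -
    obtain y where "(f, y) \<in> E" "y \<noteq> e" using other_neighbour[of f e] p by (auto simp: P_def)
    then show ?thesis using longest_end[OF R, of y] fa cf by auto
  qed
  have mid: "x \<in> {b, c, d, e}" if z: "z \<notin> P" "(z, x) \<in> E" "x \<in> P" for z x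
    using longest_end[OF L, of z] longest_end[OF R, of z] z E_sym by (auto simp: P_def)
  \<comment> \<open>Consecutive neighbours would let \<open>z\<close> be inserted into the path, and
    neighbours at distance two give a 4-cycle. For \<open>b\<close> and \<open>e\<close> the chord
    at \<open>a\<close> yields a 4-cycle or a 6-cycle.\<close>
  have at_most_one: "x = y" if z: "z \<notin> P" "(z, x) \<in> E" "(z, y) \<in> E" and xy: "x \<in> P" "y \<in> P" for x y z
  proof -
    have zV: "z \<in> V" using z E_in_V by auto
    have nz: "distinct [a, b, c, d, e, f, z]" using p(1) z by (auto simp: P_def)
    have "\<not> ((z, b) \<in> E \<and> (z, c) \<in> E)"
      using long[of "[a, b, z, c, d, e, f]"] p nz zV E_sym by (auto simp: path_def P_def)
    moreover have "\<not> ((z, c) \<in> E \<and> (z, d) \<in> E)"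
      using long[of "[a, b, c, z, d, e, f]"] p nz zV E_sym by (auto simp: path_def P_def)
    moreover have "\<not> ((z, d) \<in> E \<and> (z, e) \<in> E)"
      using long[of "[a, b, c, d, z, e, f]"] p nz zV E_sym by (auto simp: path_def P_def)
    moreover have "\<not> ((z, b) \<in> E \<and> (z, d) \<in> E)" using no_C4[of b z d c] p ps nz E_sym by auto
    moreover have "\<not> ((z, c) \<in> E \<and> (z, e) \<in> E)" using no_C4[of c z e d] p ps nz E_sym by auto
    moreover have "\<not> ((z, b) \<in> E \<and> (z, e) \<in> E)"
      using no_C6[of a b z e d c] no_C4[of a b z e] Na p ps nz E_sym by auto
    ultimately show ?thesis
      using mid[OF z(1,2) xy(1)] mid[OF z(1,3) xy(2)] z by auto
  qed
  obtain z where z: "z \<in> V" "z \<notin> P" using V p(7) by (auto simp: P_def)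
  have "\<exists>w. (z, w) \<in> E \<and> w \<notin> P"
  proof (rule ccontr)
    assume all: "\<not> ?thesis"
    obtain x where x: "(z, x) \<in> E" using other_neighbour[OF z(1)] by blast
    obtain y where y: "(z, y) \<in> E" "y \<noteq> x" using other_neighbour[OF z(1)] by blast
    show False using at_most_one[OF z(2) x y(1)] all x y by auto
  qed
  then obtain w where w: "(z, w) \<in> E" "w \<notin> P" by blast
  have wV: "w \<in> V" "w \<noteq> z" using w E_in_V irrefl by auto
  have dist: "distinct [a, b, c, d, e, f, z, w]" using p(1) z w wV by (auto simp: P_def)
  have "card {a, b, c, d, e, f, z, w} = 8" using distinct_card[OF dist] by simp
  moreover have "{a, b, c, d, e, f, z, w} \<subseteq> V" using p(7) z wV by (auto simp: P_def)
  ultimately have Veq: "V = {a, b, c, d, e, f, z, w}"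
    using card_seteq[OF finite_V] card_V by metis
  \<comment> \<open>Attached at \<open>b\<close> or \<open>e\<close>, the edge between
    \<open>u\<close> and \<open>v\<close> would replace an end of the path and give seven
    vertices.\<close>
  have ex: "\<exists>x\<in>{c, d}. (u, x) \<in> E" if u: "{u, v} = {z, w}" for u v
  proof -
    have uv: "u \<in> V" "u \<notin> P" "(u, v) \<in> E" "(v, u) \<in> E" "v \<in> V" "v \<notin> P" "u \<noteq> v"
      using u z w wV E_sym by (auto simp: doubleton_eq_iff)
    obtain x where x: "(u, x) \<in> E" "x \<noteq> v" using other_neighbour[OF uv(1)] by blast
    have "x \<noteq> u" "x \<in> V" using x irrefl E_in_V by auto
    then have xP: "x \<in> P" using x(2) u Veq by (auto simp: P_def doubleton_eq_iff)
    have "x \<noteq> b" using long[of "[v, u, b, c, d, e, f]"] x uv p by (auto simp: path_def P_def)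
    moreover have "x \<noteq> e" using long[of "[a, b, c, d, e, u, v]"] x uv p E_sym by (auto simp: path_def P_def)
    ultimately show ?thesis using mid[OF uv(2) x(1) xP] x(1) by auto
  qed
  obtain x where x: "x \<in> {c, d}" "(z, x) \<in> E" using ex[of z w] by blast
  obtain y where y: "y \<in> {c, d}" "(w, y) \<in> E" using ex[of w z] by (auto simp: insert_commute)
  have "x = y"
  proof (rule ccontr)
    assume "x \<noteq> y"
    then show False using no_C4[of x z w y] x y w p(4) ps(3) dist E_sym by auto
  qed
  have xP: "x \<in> P" using x by (auto simp: P_def)
  have uniq: "u \<in> {x, z, w}" if u: "(z, u) \<in> E \<or> (w, u) \<in> E" for u
  proof (cases "u \<in> P")
    case True
    then show ?thesis using u at_most_one[OF z(2) _ x(2) True xP] at_most_one[OF w(2) _ y(2) True] xP \<open>x = y\<close> by auto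
  next
    case False
    then show ?thesis using u E_in_V Veq by (auto simp: P_def)
  qed
  show ?thesis
  proof (cases "x = c")
    case True
    show ?thesis
      by (rule longest_6_triangle[OF L Veq dist w(1) _ _ _ Na Nf]) (use True x y \<open>x = y\<close> uniq in auto)
  next
    case False
    then have "x = d" using x by auto
    show ?thesis
      by (rule longest_6_triangle[OF R _ _ w(1), of])
        (use \<open>x = d\<close> x y \<open>x = y\<close> uniq Na Nf Veq dist in auto)
  qed
qed

text \<open>The only vertex outside has two neighbours among the five inner vertices. At distance
  one it can be inserted, at distance two it closes a 4-cycle, at distance four a 6-cycle, and at
  distance three the chord at \<open>a\<close> or \<open>g\<close> supplies a 4-cycle or a
  6-cycle.\<close>

lemma not_longest_7:
  assumes L: "longest [a, b, c, d, e, f, g]" and V: "set [a, b, c, d, e, f, g] \<noteq> V"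
  shows False
proof -
  define P where "P = {a, b, c, d, e, f, g}"
  have p: "distinct [a, b, c, d, e, f, g]" "(a, b) \<in> E" "(b, c) \<in> E" "(c, d) \<in> E" "(d, e) \<in> E" "(e, f) \<in> E"
      "(f, g) \<in> E" "P \<subseteq> V"
    using L by (auto simp: longest_def path_def P_def)
  have ps: "(b, a) \<in> E" "(c, b) \<in> E" "(d, c) \<in> E" "(e, d) \<in> E" "(f, e) \<in> E" "(g, f) \<in> E" using p E_sym by auto
  have R: "longest [g, f, e, d, c, b, a]" using longest_rev[OF L] by simp
  have long: False if "path q" "length q > 7" for q using L that by (fastforce simp: longest_def)
  have ga: "(g, a) \<notin> E" "(a, g) \<notin> E" using longest_not_closed[OF L _ V] E_sym by auto
  have ad: "(a, d) \<notin> E" using no_C4[of a b c d] p E_sym by auto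
  have af: "(a, f) \<notin> E" using no_C6[of a b c d e f] p E_sym by auto
  have gd: "(g, d) \<notin> E" using no_C4[of g d e f] p ps E_sym by auto
  have gb: "(g, b) \<notin> E" using no_C6[of g b c d e f] p ps E_sym by auto
  have Na: "(a, c) \<in> E \<or> (a, e) \<in> E"
  proof -
    obtain y where "(a, y) \<in> E" "y \<noteq> b" using other_neighbour[of a b] p by (auto simp: P_def)
    then show ?thesis using longest_end[OF L, of y] ga ad af by auto
  qed
  have Ng: "(g, e) \<in> E \<or> (g, c) \<in> E"
  proof -
    obtain y where "(g, y) \<in> E" "y \<noteq> f" using other_neighbour[of g f] p by (auto simp: P_def)
    then show ?thesis using longest_end[OF R, of y] ga gd gb by auto
  qed
  obtain z where z: "z \<in> V" "z \<notin> P" using V p(8) by (auto simp: P_def)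
  have dist: "distinct [a, b, c, d, e, f, g, z]" using p(1) z by (auto simp: P_def)
  have "card {a, b, c, d, e, f, g, z} = 8" using distinct_card[OF dist] by simp
  moreover have "{a, b, c, d, e, f, g, z} \<subseteq> V" using p(8) z by (auto simp: P_def)
  ultimately have Veq: "V = {a, b, c, d, e, f, g, z}"
    using card_seteq[OF finite_V] card_V by metis
  have mid: "x \<in> {b, c, d, e, f}" if zx: "(z, x) \<in> E" for x
  proof -
    have "x \<in> P" using zx Veq E_in_V irrefl by (auto simp: P_def)
    then show ?thesis using longest_end[OF L, of z] longest_end[OF R, of z] z zx E_sym by (auto simp: P_def)
  qed
  have "\<not> ((z, b) \<in> E \<and> (z, c) \<in> E)"
    using long[of "[a, b, z, c, d, e, f, g]"] p dist z E_sym by (auto simp: path_def P_def)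
  moreover have "\<not> ((z, c) \<in> E \<and> (z, d) \<in> E)"
    using long[of "[a, b, c, z, d, e, f, g]"] p dist z E_sym by (auto simp: path_def P_def)
  moreover have "\<not> ((z, d) \<in> E \<and> (z, e) \<in> E)"
    using long[of "[a, b, c, d, z, e, f, g]"] p dist z E_sym by (auto simp: path_def P_def)
  moreover have "\<not> ((z, e) \<in> E \<and> (z, f) \<in> E)"
    using long[of "[a, b, c, d, e, z, f, g]"] p dist z E_sym by (auto simp: path_def P_def)
  moreover have "\<not> ((z, b) \<in> E \<and> (z, d) \<in> E)" using no_C4[of b z d c] p ps dist E_sym by auto
  moreover have "\<not> ((z, c) \<in> E \<and> (z, e) \<in> E)" using no_C4[of c z e d] p ps dist E_sym by auto
  moreover have "\<not> ((z, d) \<in> E \<and> (z, f) \<in> E)" using no_C4[of d z f e] p ps dist E_sym by auto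
  moreover have "\<not> ((z, b) \<in> E \<and> (z, f) \<in> E)" using no_C6[of b c d e f z] p ps dist E_sym by auto
  moreover have "\<not> ((z, b) \<in> E \<and> (z, e) \<in> E)"
    using no_C6[of a b z e d c] no_C4[of a b z e] Na p ps dist E_sym by auto
  moreover have "\<not> ((z, c) \<in> E \<and> (z, f) \<in> E)"
    using no_C6[of g f z c d e] no_C4[of g f z c] Ng p ps dist E_sym by auto
  moreover obtain x where x: "(z, x) \<in> E" using other_neighbour[OF z(1)] by blast
  moreover obtain y where y: "(z, y) \<in> E" "y \<noteq> x" using other_neighbour[OF z(1)] by blast
  ultimately show False using mid[OF x] mid[OF y(1)] by auto
qed

lemma hamiltonian_path:
  assumes "path p" "set p = V" "p \<noteq> []"
  shows "two_proper_connected V E"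
proof -
  obtain v q where p: "p = v # q" using assms(3) by (cases p) auto
  have "chain ({v} \<union> set q) v (last (v # q))"
    using assms p by (intro chain_append chain_singleton) (auto simp: path_def)
  then show ?thesis using assms(2) p chain_V by simp
qed

lemma two_proper_connected_or_isomorphic:
  assumes "V \<noteq> {}"
  shows "two_proper_connected V E \<or> isomorphic_to V E G1 \<or> isomorphic_to V E G2"
proof -
  have "path []" by (simp add: path_def)
  moreover have "\<forall>q. path q \<longrightarrow> length q < Suc (card V)"
    using finite_V by (auto simp: path_def less_Suc_eq_le distinct_card[symmetric] card_mono)
  ultimately obtain p where L: "longest p"
    using ex_has_greatest_nat[of path "[]" length] unfolding longest_def by blast
  obtain v where "v \<in> V" using assms by blast
  then have "path [v]" by (simp add: path_def)
  then have "p \<noteq> []" using L by (auto simp: longest_def)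
  show ?thesis
  proof (cases "set p = V")
    case True
    then show ?thesis using hamiltonian_path[of p] L \<open>p \<noteq> []\<close> by (simp add: longest_def)
  next
    case False
    have pp: "path p" using L by (simp add: longest_def)
    then have "set p \<subset> V" using False by (auto simp: path_def)
    then have "card (set p) < card V" using finite_V by (rule psubset_card_mono[rotated])
    then have "length p < 8" using pp card_V by (simp add: path_def distinct_card)
    moreover have "0 < length p" using \<open>p \<noteq> []\<close> by simp
    \<comment> \<open>A path of at most four vertices is impossible: the second neighbours of its
      ends lie on it and either close it or create a 4-cycle.\<close>
    ultimately consider "length p = 1" | "length p = 2" | "length p = 3" | "length p = 4" | "length p = 5"
      | "length p = 6" | "length p = 7" by linarith
    then show ?thesis
    proof cases
      case 1
      then obtain a where p: "p = [a]" by (auto simp: length_Suc_conv eval_nat_numeral)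
      then obtain y where "(a, y) \<in> E" using other_neighbour[of a a] pp by (auto simp: path_def)
      then show ?thesis using longest_end[of a "[]"] L p by auto
    next
      case 2
      then obtain a b where p: "p = [a, b]" by (auto simp: length_Suc_conv eval_nat_numeral)
      then obtain y where "(a, y) \<in> E" "y \<noteq> b" using other_neighbour[of a b] pp by (auto simp: path_def)
      then show ?thesis using longest_end[of a "[b]"] L p by auto
    next
      case 3
      then obtain a b c where p: "p = [a, b, c]" by (auto simp: length_Suc_conv eval_nat_numeral)
      then obtain y where "(a, y) \<in> E" "y \<noteq> b" using other_neighbour[of a b] pp by (auto simp: path_def)
      then have "(a, c) \<in> E" using longest_end[of a "[b, c]"] L p by auto
      then show ?thesis using longest_not_closed[OF L _ False] p E_sym by auto
    next
      case 4
      then obtain a b c d where p: "p = [a, b, c, d]" by (auto simp: length_Suc_conv eval_nat_numeral)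
      have d: "distinct [a, b, c, d]" "(a, b) \<in> E" "(b, c) \<in> E" "(c, d) \<in> E" "a \<in> V" "d \<in> V"
        using pp p by (auto simp: path_def)
      have R: "longest [d, c, b, a]" using longest_rev[OF L] p by simp
      have da: "(d, a) \<notin> E" "(a, d) \<notin> E" using longest_not_closed[OF L _ False] p E_sym by auto
      obtain y where "(a, y) \<in> E" "y \<noteq> b" using other_neighbour[of a b] d by auto
      then have "(a, c) \<in> E" using longest_end[of a "[b, c, d]"] L p da by auto
      moreover obtain y where "(d, y) \<in> E" "y \<noteq> c" using other_neighbour[of d c] d by auto
      then have "(d, b) \<in> E" using longest_end[OF R] da by auto
      ultimately show ?thesis using no_C4[of a b d c] d E_sym by auto
    next
      case 5
      then obtain a b c d e where "p = [a, b, c, d, e]" by (auto simp: length_Suc_conv eval_nat_numeral)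
      then show ?thesis using longest_5 L False by blast
    next
      case 6
      then obtain a b c d e f where "p = [a, b, c, d, e, f]" by (auto simp: length_Suc_conv eval_nat_numeral)
      then show ?thesis using longest_6 L False by blast
    next
      case 7
      then obtain a b c d e f g where "p = [a, b, c, d, e, f, g]"
        by (auto simp: length_Suc_conv eval_nat_numeral)
      then show ?thesis using not_longest_7 L False by blast
    qed
  qed
qed

end

section \<open>From symmetric relations to pair graphs\<close>

context small_graph
begin

lemma two_proper_connected_or_exceptional:
  assumes "V \<noteq> {}"
  shows "two_proper_connected V E \<or> isomorphic_to V E G1 \<or> isomorphic_to V E G2"
proof (cases "\<exists>f D S. strong_on f D S \<and> 4 \<le> card S")
  case True
  then obtain f0 D0 S0 where S0: "strong_on f0 D0 S0" "4 \<le> card S0" by blast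
  let ?Q = "\<lambda>S. \<exists>f D. strong_on f D S"
  have "\<forall>S. ?Q S \<longrightarrow> card S < Suc (card V)"
    using finite_V by (auto simp: strong_on_def less_Suc_eq_le intro: card_mono)
  then obtain S where "?Q S" and max: "\<And>T. ?Q T \<Longrightarrow> card T \<le> card S"
    using ex_has_greatest_nat[of ?Q S0 card] S0(1) by blast
  then obtain f D where S: "strong_on f D S" by blast
  have "4 \<le> card S" using max[of S0] S0 by fastforce
  then show ?thesis using two_proper_connected_even_cycle[OF S] max by blast
next
  case False
  then interpret cactus_graph V E by unfold_locales (use not_le in blast)
  show ?thesis using two_proper_connected_or_isomorphic[OF assms] .
qed

end

lemma (in pair_wf_digraph) isomorphic_to_imp_digraph_iso:
  assumes "isomorphic_to (pverts G) (parcs G) H"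
  shows "digraph_iso G H"
proof -
  obtain g where g: "inj_on g (pverts G)" "g ` pverts G = pverts H" "map_prod g g ` parcs G = parcs H"
    using assms unfolding isomorphic_to_def by blast
  have "inj_on (map_prod g g) (parcs G)"
    by (rule inj_on_subset[OF map_prod_inj_on[OF g(1,1)]]) (use in_arcsD1 in_arcsD2 in auto)
  then have "digraph_isomorphism
      \<lparr>iso_verts = g, iso_arcs = map_prod g g, iso_head = snd, iso_tail = fst\<rparr>"
    using g(1) by (auto simp: digraph_isomorphism_def wf_digraph_axioms)
  moreover have "with_proj H = app_iso
      \<lparr>iso_verts = g, iso_arcs = map_prod g g, iso_head = snd, iso_tail = fst\<rparr> (with_proj G)"
    using g(2,3) by (simp add: app_iso_def with_proj_def)
  ultimately show ?thesis unfolding digraph_iso_def by blast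
qed

text \<open>The library's \<open>connected\<close> refers to the symmetric closure. As
  \<open>G\<close> is symmetric already, a walk there from \<open>S\<close> to its complement uses
  an arc of \<open>G\<close> that leaves \<open>S\<close>.\<close>

lemma (in pair_graph) connected_imp_conn_graph:
  assumes "connected G"
  shows "conn_graph (pverts G) (parcs G)"
proof
  show "finite (pverts G)" by (rule pair_finite_verts)
  show "parcs G \<subseteq> pverts G \<times> pverts G" using in_arcsD1 in_arcsD2 by auto
  show "sym (parcs G)" using arcs_symmetric by (auto intro: symI)
  fix S assume S: "S \<subseteq> pverts G" "S \<noteq> {}" "S \<noteq> pverts G"
  then obtain u v where uv: "u \<in> S" "v \<in> pverts G" "v \<notin> S" by blast
  show "boundary (parcs G) S \<noteq> {}"
  proof
    assume empty: "boundary (parcs G) S = {}"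
    have "u \<rightarrow>\<^sup>*\<^bsub>with_proj (mk_symmetric G)\<^esub> v"
      using assms uv S by (auto simp: connected_def strongly_connected_def mk_symmetric_def)
    then have "(u, v) \<in> rtrancl_on (pverts G) (parcs (mk_symmetric G))"
      by (simp add: reachable_def mk_symmetric_def)
    then have "v \<in> S"
    proof (induction rule: rtrancl_on_induct)
      case (step y z)
      then have "(y, z) \<in> parcs G" using arcs_symmetric by (auto simp: mk_symmetric_def)
      then show ?case using step empty by (auto simp: boundary_def)
    qed (use uv in simp)
    then show False using uv by simp
  qed
qed

lemma (in pair_fin_digraph) min_degree_le:
  assumes "x \<in> pverts G"
  shows "min_degree G \<le> card (parcs G `` {x})"
proof -
  have "parcs G `` {x} = snd ` out_arcs (with_proj G) x" by (force simp: out_arcs_def)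
  moreover have "inj_on snd (out_arcs (with_proj G) x)" by (auto simp: out_arcs_def inj_on_def)
  ultimately have "card (parcs G `` {x}) = out_degree (with_proj G) x"
    by (simp add: card_image out_degree_def)
  then show ?thesis
    using assms pair_finite_verts by (auto simp: min_degree_def)
qed

text \<open>A proper path between two nonadjacent vertices has at least two edges, and its first two
  differ in colour.\<close>

lemma (in pair_graph) two_le_card_colors:
  assumes "\<not> complete_digraph (card (pverts G)) G" "proper_connected G c"
  shows "2 \<le> card (c ` uedges G)"
proof -
  obtain u v where uv: "u \<in> pverts G" "v \<in> pverts G" "u \<noteq> v" "(u, v) \<notin> parcs G"
    using assms(1) pair_finite_verts in_arcsD1 in_arcsD2 no_loops'
    unfolding complete_digraph_pair_def by blast
  then obtain p where p: "proper_path G c p" "hd p = u" "last p = v"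
    using assms(2) by (auto simp: proper_connected_def)
  have walk: "set (vwalk_arcs p) \<subseteq> parcs G" "p \<noteq> []"
    using p(1) by (auto simp: proper_path_def vpath_def vwalk_def)
  have "\<exists>w r. p = u # w # r" using p walk uv by (cases p; cases "tl p") auto
  then obtain w r where p': "p = u # w # r" by blast
  moreover have "r \<noteq> []" using p' p(3) walk uv by auto
  ultimately obtain x r' where p'': "p = u # w # x # r'" by (cases r) auto
  then have "(u, w) \<in> parcs G" "(w, x) \<in> parcs G" using walk by auto
  then have e: "{u, w} \<in> uedges G" "{w, x} \<in> uedges G" unfolding uedges_def by blast+
  have "c {u, w} \<noteq> c {w, x}" using p(1) p'' by (auto simp: proper_path_def dest: spec[of _ 0])
  then have "card {c {u, w}, c {w, x}} = 2" by simp
  moreover have "finite (uedges G)"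
  proof -
    have "uedges G \<subseteq> Pow (pverts G)" using in_arcsD1 in_arcsD2 by (auto simp: uedges_def)
    then show ?thesis using pair_finite_verts by (auto intro: finite_subset)
  qed
  ultimately show ?thesis using e card_mono[of "c ` uedges G" "{c {u, w}, c {w, x}}"] by auto
qed

lemma (in pair_graph) proper_connection_number_eq_2:
  assumes "\<not> complete_digraph (card (pverts G)) G" "two_proper_connected (pverts G) (parcs G)"
  shows "proper_connection_number G = 2"
proof -
  obtain c where c': "proper_connected \<lparr>pverts = pverts G, parcs = parcs G\<rparr> c" "range c \<subseteq> {0, 1}"
    using assms(2) unfolding two_proper_connected_def by blast
  have "\<lparr>pverts = pverts G, parcs = parcs G\<rparr> = G" by simp
  then have c: "proper_connected G c" using c'(1) by (simp only:)
  have "c ` uedges G \<subseteq> {0, 1}" by (rule order_trans[OF image_mono[OF subset_UNIV] c'(2)])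
  then have "card (c ` uedges G) \<le> card {0 :: nat, 1}" by (intro card_mono) auto
  then have "card (c ` uedges G) = 2" using two_le_card_colors[OF assms(1) c] by simp
  then show ?thesis
    unfolding proper_connection_number_def
    using c two_le_card_colors[OF assms(1)] by (intro Least_equality) auto
qed

theorem theorem2:
  fixes G :: "'a pair_pre_digraph" and n :: nat
  assumes "pair_graph G"
    and "connected G"
    and "card (pverts G) = n"
    and "n \<ge> 5"
    and "\<not> complete_digraph n G"
    and "real (min_degree G) \<ge> real n / 4"
    and "\<not> digraph_iso G G1"
    and "\<not> digraph_iso G G2"
  shows "proper_connection_number G = 2"
proof -
  interpret G: pair_graph G by fact
  interpret conn_graph "pverts G" "parcs G" using G.connected_imp_conn_graph[OF assms(2)] .
  have irrefl: "(x, x) \<notin> parcs G" for x using G.no_loops' by auto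
  have n_le: "n \<le> 4 * min_degree G" using assms(6) by linarith
  have "two_proper_connected (pverts G) (parcs G)"
  proof (cases "3 \<le> min_degree G")
    case True
    then show ?thesis
      using two_proper_connected_min_degree_ge_3[OF conn_graph_axioms irrefl G.min_degree_le] n_le assms(3)
      by simp
  next
    case False
    \<comment> \<open>The minimum degree is exactly two here: \<open>n \<ge> 5\<close> and
      \<open>n \<le> 4 * min_degree G\<close> exclude smaller values.\<close>
    interpret small_graph "pverts G" "parcs G"
    proof
      show "(x, x) \<notin> parcs G" for x by (rule irrefl)
      show "card (pverts G) \<le> 8" using False n_le assms(3) by simp
      show "\<exists>z. (x, z) \<in> parcs G \<and> z \<noteq> y" if x: "x \<in> pverts G" for x y
      proof (rule ccontr)
        assume "\<not> ?thesis"
        then have "parcs G `` {x} \<subseteq> {y}" by auto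
        then have "card (parcs G `` {x}) \<le> 1" using card_mono[of "{y}"] by fastforce
        then show False using G.min_degree_le[OF x] n_le assms(4) by linarith
      qed
    qed
    have "pverts G \<noteq> {}" using assms(3,4) by auto
    then show ?thesis
      using two_proper_connected_or_exceptional G.isomorphic_to_imp_digraph_iso assms(7,8) by blast
  qed
  then show ?thesis using G.proper_connection_number_eq_2 assms(3,5) by simp
qed

end
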